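(* There exist no (non-trivial) biwarped product submanifolds of type $M_T\times_f M_\phi\times_\sigma M_\bot$ of a Kähler manifold $(\bar M,J,g)$ such that $M_T$ is a holomorphic, $M_\phi$ is a proper slant and $M_\bot$ is a totally real submanifold of $\bar M$.
   Context: A Kähler manifold $(\bar M,J,g)$ is an almost complex manifold with Riemannian metric $g$ with $g(JX,JY)=g(X,Y)$ and $\bar\nabla J=0$, where $\bar\nabla$ is the Levi-Civita connection. A submanifold $N$ of $\bar M$ is slant if the angle $\phi$ between $JV$ and $T_pN$ is independent of both the point $p\in N$ and the nonzero vector $V\in T_pN$; it is proper slant if $\cos\phi\neq0$ and $\sin\phi\neq0$. $N$ is holomorphic if $J(T_pN)\subseteq T_pN$ for all $p$, and totally real if $J(T_pN)\subseteq T_p^\bot N$ for all $p$. For Riemannian manifolds $(M_i,g_i)$, $i=0,1,2$, and smooth $f_1,f_2:M_0\to(0,\infty)$, the biwarped product $M_0\times_{f_1}M_1\times_{f_2}M_2$ is $M_0\times M_1\times M_2$ with metric $\pi_0^*g_0+(f_1\circ\pi_0)^2\pi_1^*g_1+(f_2\circ\pi_0)^2\pi_2^*g_2$, $\pi_i$ being the projections. It is called trivial if the warping functions $f_1$ and $f_2$ are constants. A biwarped product submanifold of $\bar M$ is an isometrically immersed submanifold of $\bar M$ that is a biwarped product with its induced metric.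
   Formalization: Read literally (trivial = both f and σ constant) the claim fails: in C^4 there is an example with f = 1 and σ = |z|. What is proved is that f, the warping function of the slant factor, must be constant, for connected M_T and one slant angle φ for all copies of M_φ. *)

theory Defs
  imports "HOL-Analysis.Analysis"
begin

section \<open>Smooth maps between open subsets of Euclidean spaces\<close>

text \<open>\<open>Ck_on k S f\<close> is meant for open \<open>S\<close>: \<open>f\<close> has continuous partial derivatives up to order
  \<open>k\<close> on \<open>S\<close>.\<close>

primrec Ck_on :: "nat \<Rightarrow> 'a::euclidean_space set \<Rightarrow> ('a \<Rightarrow> 'b::euclidean_space) \<Rightarrow> bool" where
  "Ck_on 0 S f \<longleftrightarrow> continuous_on S f"
| "Ck_on (Suc k) S f \<longleftrightarrow>
     (\<forall>x\<in>S. f differentiable (at x)) \<and> (\<forall>v. Ck_on k S (\<lambda>x. frechet_derivative f (at x) v))"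

definition smooth_on :: "'a::euclidean_space set \<Rightarrow> ('a \<Rightarrow> 'b::euclidean_space) \<Rightarrow> bool" where
  "smooth_on S f \<longleftrightarrow> (\<forall>k. Ck_on k S f)"


section \<open>Smooth manifolds\<close>

text \<open>A chart is a pair of its domain and its coordinate map.  A manifold is modelled on a Euclidean
  space type \<open>'e\<close>, whose dimension is arbitrary but positive.\<close>

type_synonym ('a, 'e) chart = "'a set \<times> ('a \<Rightarrow> 'e)"

definition chart_inv :: "('a, 'e) chart \<Rightarrow> 'e \<Rightarrow> 'a" where
  "chart_inv c = inv_into (fst c) (snd c)"

record ('a, 'e) manifold =
  mtop :: "'a topology"
  atlas :: "('a, 'e) chart set"

abbreviation points :: "('a, 'e) manifold \<Rightarrow> 'a set" where
  "points M \<equiv> topspace (mtop M)"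

definition smooth_manifold :: "('a, 'e::euclidean_space) manifold \<Rightarrow> bool" where
  "smooth_manifold M \<longleftrightarrow>
     Hausdorff_space (mtop M) \<and> second_countable (mtop M) \<and> points M \<noteq> {} \<and>
     (\<Union>c\<in>atlas M. fst c) = points M \<and>
     (\<forall>c\<in>atlas M. openin (mtop M) (fst c) \<and> open (snd c ` fst c) \<and>
        homeomorphic_map (subtopology (mtop M) (fst c)) (top_of_set (snd c ` fst c)) (snd c)) \<and>
     (\<forall>c\<in>atlas M. \<forall>d\<in>atlas M. smooth_on (snd c ` (fst c \<inter> fst d)) (snd d \<circ> chart_inv c))"

text \<open>At every point one chart around it is fixed once and for all, and the tangent space at \<open>p\<close>
  is the model space \<open>'e\<close>: the vector \<open>v :: 'e\<close> stands for the tangent vector whose components in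
  the chart \<open>chart_at M p\<close> are \<open>v\<close>.  Its components in another chart \<open>c\<close> around \<open>p\<close> are
  \<open>tcoord M c p v\<close>.  A vector field is therefore a function \<open>'a \<Rightarrow> 'e\<close>, whose smoothness
  has to be tested on its components in the charts of the atlas.\<close>

definition chart_at :: "('a, 'e) manifold \<Rightarrow> 'a \<Rightarrow> ('a, 'e) chart" where
  "chart_at M p = (SOME c. c \<in> atlas M \<and> p \<in> fst c)"

definition coord_at :: "('a, 'e) manifold \<Rightarrow> 'a \<Rightarrow> 'e" where
  "coord_at M p = snd (chart_at M p) p"

definition tcoord :: "('a, 'e::euclidean_space) manifold \<Rightarrow> ('a, 'e) chart \<Rightarrow> 'a \<Rightarrow> 'e \<Rightarrow> 'e" where
  "tcoord M c p v = frechet_derivative (snd c \<circ> chart_inv (chart_at M p)) (at (coord_at M p)) v"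

definition smooth_vfield :: "('a, 'e::euclidean_space) manifold \<Rightarrow> 'a set \<Rightarrow> ('a \<Rightarrow> 'e) \<Rightarrow> bool" where
  "smooth_vfield M W X \<longleftrightarrow>
     (\<forall>c\<in>atlas M. smooth_on (snd c ` (fst c \<inter> W)) (\<lambda>x. tcoord M c (chart_inv c x) (X (chart_inv c x))))"

definition smooth_fun :: "('a, 'e::euclidean_space) manifold \<Rightarrow> 'a set \<Rightarrow> ('a \<Rightarrow> real) \<Rightarrow> bool" where
  "smooth_fun M W h \<longleftrightarrow> (\<forall>c\<in>atlas M. smooth_on (snd c ` (fst c \<inter> W)) (h \<circ> chart_inv c))"

definition dir_deriv :: "('a, 'e::euclidean_space) manifold \<Rightarrow> ('a \<Rightarrow> real) \<Rightarrow> 'a \<Rightarrow> 'e \<Rightarrow> real" where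
  "dir_deriv M h p v = frechet_derivative (h \<circ> chart_inv (chart_at M p)) (at (coord_at M p)) v"

text \<open>In coordinates, \<open>[X, Y] = DY(X) - DX(Y)\<close>.\<close>

definition lie_bracket ::
    "('a, 'e::euclidean_space) manifold \<Rightarrow> ('a \<Rightarrow> 'e) \<Rightarrow> ('a \<Rightarrow> 'e) \<Rightarrow> 'a \<Rightarrow> 'e" where
  "lie_bracket M X Y p =
     (let c = chart_at M p; loc = (\<lambda>Z x. tcoord M c (chart_inv c x) (Z (chart_inv c x)))
      in frechet_derivative (loc Y) (at (snd c p)) (X p) - frechet_derivative (loc X) (at (snd c p)) (Y p))"

definition smooth_map ::
    "('a, 'e::euclidean_space) manifold \<Rightarrow> ('b, 'f::euclidean_space) manifold \<Rightarrow> ('a \<Rightarrow> 'b) \<Rightarrow> bool" where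
  "smooth_map M N F \<longleftrightarrow>
     continuous_map (mtop M) (mtop N) F \<and>
     (\<forall>c\<in>atlas M. \<forall>d\<in>atlas N. smooth_on (snd c ` (fst c \<inter> F -` fst d)) (snd d \<circ> F \<circ> chart_inv c))"

definition differential ::
    "('a, 'e::euclidean_space) manifold \<Rightarrow> ('b, 'f::euclidean_space) manifold \<Rightarrow> ('a \<Rightarrow> 'b)
     \<Rightarrow> 'a \<Rightarrow> 'e \<Rightarrow> 'f" where
  "differential M N F p v =
     frechet_derivative (snd (chart_at N (F p)) \<circ> F \<circ> chart_inv (chart_at M p)) (at (coord_at M p)) v"

definition prod_manifold ::
    "('a, 'e) manifold \<Rightarrow> ('b, 'f) manifold \<Rightarrow> ('a \<times> 'b, 'e \<times> 'f) manifold" where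
  "prod_manifold M N =
     \<lparr>mtop = prod_topology (mtop M) (mtop N),
      atlas = {(fst c \<times> fst d, map_prod (snd c) (snd d)) | c d. c \<in> atlas M \<and> d \<in> atlas N}\<rparr>"


section \<open>Riemannian and Kaehler manifolds\<close>

definition riemannian_metric ::
    "('a, 'e::euclidean_space) manifold \<Rightarrow> ('a \<Rightarrow> 'e \<Rightarrow> 'e \<Rightarrow> real) \<Rightarrow> bool" where
  "riemannian_metric M g \<longleftrightarrow>
     (\<forall>p\<in>points M. bilinear (g p) \<and> (\<forall>u v. g p u v = g p v u) \<and> (\<forall>v. v \<noteq> 0 \<longrightarrow> g p v v > 0)) \<and>
     (\<forall>W X Y. openin (mtop M) W \<and> smooth_vfield M W X \<and> smooth_vfield M W Y
        \<longrightarrow> smooth_fun M W (\<lambda>p. g p (X p) (Y p)))"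

definition riemannian_manifold ::
    "('a, 'e::euclidean_space) manifold \<Rightarrow> ('a \<Rightarrow> 'e \<Rightarrow> 'e \<Rightarrow> real) \<Rightarrow> bool" where
  "riemannian_manifold M g \<longleftrightarrow> smooth_manifold M \<and> riemannian_metric M g"

text \<open>\<open>nab p v Y\<close> is the covariant derivative at \<open>p\<close> of the field \<open>Y\<close> in the direction \<open>v\<close>.  Fields
  defined on open subsets \<open>W\<close> are admitted; a connection on global fields extends uniquely to them,
  and the locality clause says that only the germ of \<open>Y\<close> at \<open>p\<close> matters.\<close>

definition affine_connection ::
    "('a, 'e::euclidean_space) manifold \<Rightarrow> ('a \<Rightarrow> 'e \<Rightarrow> ('a \<Rightarrow> 'e) \<Rightarrow> 'e) \<Rightarrow> bool" where
  "affine_connection M nab \<longleftrightarrow>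
     (\<forall>W X Y. openin (mtop M) W \<and> smooth_vfield M W X \<and> smooth_vfield M W Y
        \<longrightarrow> smooth_vfield M W (\<lambda>p. nab p (X p) Y)) \<and>
     (\<forall>W Y. \<forall>p\<in>W. openin (mtop M) W \<and> smooth_vfield M W Y \<longrightarrow> linear (\<lambda>v. nab p v Y)) \<and>
     (\<forall>W Y Z v. \<forall>p\<in>W. openin (mtop M) W \<and> smooth_vfield M W Y \<and> (\<forall>q\<in>W. Y q = Z q)
        \<longrightarrow> nab p v Y = nab p v Z) \<and>
     (\<forall>W Y Z v. \<forall>p\<in>W. openin (mtop M) W \<and> smooth_vfield M W Y \<and> smooth_vfield M W Z
        \<longrightarrow> nab p v (\<lambda>q. Y q + Z q) = nab p v Y + nab p v Z) \<and>
     (\<forall>W h Y v. \<forall>p\<in>W. openin (mtop M) W \<and> smooth_fun M W h \<and> smooth_vfield M W Y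
        \<longrightarrow> nab p v (\<lambda>q. h q *\<^sub>R Y q) = dir_deriv M h p v *\<^sub>R Y p + h p *\<^sub>R nab p v Y)"

definition levi_civita_connection ::
    "('a, 'e::euclidean_space) manifold \<Rightarrow> ('a \<Rightarrow> 'e \<Rightarrow> 'e \<Rightarrow> real)
     \<Rightarrow> ('a \<Rightarrow> 'e \<Rightarrow> ('a \<Rightarrow> 'e) \<Rightarrow> 'e) \<Rightarrow> bool" where
  "levi_civita_connection M g nab \<longleftrightarrow>
     affine_connection M nab \<and>
     (\<forall>W X Y. \<forall>p\<in>W. openin (mtop M) W \<and> smooth_vfield M W X \<and> smooth_vfield M W Y
        \<longrightarrow> nab p (X p) Y - nab p (Y p) X = lie_bracket M X Y p) \<and>
     (\<forall>W Y Z v. \<forall>p\<in>W. openin (mtop M) W \<and> smooth_vfield M W Y \<and> smooth_vfield M W Z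
        \<longrightarrow> dir_deriv M (\<lambda>q. g q (Y q) (Z q)) p v = g p (nab p v Y) (Z p) + g p (Y p) (nab p v Z))"

definition almost_complex_structure ::
    "('a, 'e::euclidean_space) manifold \<Rightarrow> ('a \<Rightarrow> 'e \<Rightarrow> 'e) \<Rightarrow> bool" where
  "almost_complex_structure M J \<longleftrightarrow>
     (\<forall>p\<in>points M. linear (J p) \<and> (\<forall>v. J p (J p v) = - v)) \<and>
     (\<forall>W X. openin (mtop M) W \<and> smooth_vfield M W X \<longrightarrow> smooth_vfield M W (\<lambda>p. J p (X p)))"

text \<open>The existential quantifier binds the Levi-Civita connection, which is unique where it matters
  (on smooth fields).\<close>

definition kaehler_manifold ::
    "('a, 'e::euclidean_space) manifold \<Rightarrow> ('a \<Rightarrow> 'e \<Rightarrow> 'e) \<Rightarrow> ('a \<Rightarrow> 'e \<Rightarrow> 'e \<Rightarrow> real) \<Rightarrow> bool" where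
  "kaehler_manifold M J g \<longleftrightarrow>
     riemannian_manifold M g \<and> almost_complex_structure M J \<and>
     (\<forall>p\<in>points M. \<forall>u v. g p (J p u) (J p v) = g p u v) \<and>
     (\<exists>nab. levi_civita_connection M g nab \<and>
        (\<forall>W Y v. \<forall>p\<in>W. openin (mtop M) W \<and> smooth_vfield M W Y
           \<longrightarrow> nab p v (\<lambda>q. J q (Y q)) = J p (nab p v Y)))"


section \<open>Submanifolds\<close>

text \<open>A submanifold is given by an immersion \<open>F\<close> of a manifold \<open>N\<close> into \<open>M\<close>; its tangent space at
  \<open>F p\<close> is the image of the differential of \<open>F\<close> at \<open>p\<close>.\<close>

definition isometric_immersion ::
    "('b, 'f::euclidean_space) manifold \<Rightarrow> ('b \<Rightarrow> 'f \<Rightarrow> 'f \<Rightarrow> real)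
     \<Rightarrow> ('a, 'e::euclidean_space) manifold \<Rightarrow> ('a \<Rightarrow> 'e \<Rightarrow> 'e \<Rightarrow> real) \<Rightarrow> ('b \<Rightarrow> 'a) \<Rightarrow> bool" where
  "isometric_immersion N gN M gM F \<longleftrightarrow>
     smooth_map N M F \<and>
     (\<forall>p\<in>points N. inj (differential N M F p) \<and>
        (\<forall>u v. gM (F p) (differential N M F p u) (differential N M F p v) = gN p u v))"

definition tangent_image ::
    "('b, 'f::euclidean_space) manifold \<Rightarrow> ('a, 'e::euclidean_space) manifold \<Rightarrow> ('b \<Rightarrow> 'a)
     \<Rightarrow> 'b \<Rightarrow> 'e set" where
  "tangent_image N M F p = range (differential N M F p)"

definition orth_projection ::
    "('e::real_vector \<Rightarrow> 'e \<Rightarrow> real) \<Rightarrow> 'e set \<Rightarrow> 'e \<Rightarrow> 'e" where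
  "orth_projection ip T w = (THE t. t \<in> T \<and> (\<forall>s\<in>T. ip (w - t) s = 0))"

text \<open>The angle, in \<open>[0, pi/2]\<close>, between a nonzero vector and a subspace: its cosine is the ratio of
  the length of the orthogonal projection to the length of the vector.\<close>

definition angle_to_subspace ::
    "('e::real_vector \<Rightarrow> 'e \<Rightarrow> real) \<Rightarrow> 'e \<Rightarrow> 'e set \<Rightarrow> real" where
  "angle_to_subspace ip w T =
     (let t = orth_projection ip T w in arccos (sqrt (ip t t) / sqrt (ip w w)))"

definition slant_submanifold ::
    "('b, 'f::euclidean_space) manifold \<Rightarrow> ('a, 'e::euclidean_space) manifold \<Rightarrow> ('a \<Rightarrow> 'e \<Rightarrow> 'e)
     \<Rightarrow> ('a \<Rightarrow> 'e \<Rightarrow> 'e \<Rightarrow> real) \<Rightarrow> ('b \<Rightarrow> 'a) \<Rightarrow> real \<Rightarrow> bool" where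
  "slant_submanifold N M J g F \<phi> \<longleftrightarrow>
     (\<forall>p\<in>points N. \<forall>V\<in>tangent_image N M F p. V \<noteq> 0 \<longrightarrow>
        angle_to_subspace (g (F p)) (J (F p) V) (tangent_image N M F p) = \<phi>)"

definition proper_slant_submanifold ::
    "('b, 'f::euclidean_space) manifold \<Rightarrow> ('a, 'e::euclidean_space) manifold \<Rightarrow> ('a \<Rightarrow> 'e \<Rightarrow> 'e)
     \<Rightarrow> ('a \<Rightarrow> 'e \<Rightarrow> 'e \<Rightarrow> real) \<Rightarrow> ('b \<Rightarrow> 'a) \<Rightarrow> real \<Rightarrow> bool" where
  "proper_slant_submanifold N M J g F \<phi> \<longleftrightarrow>
     slant_submanifold N M J g F \<phi> \<and> cos \<phi> \<noteq> 0 \<and> sin \<phi> \<noteq> 0"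

definition holomorphic_submanifold ::
    "('b, 'f::euclidean_space) manifold \<Rightarrow> ('a, 'e::euclidean_space) manifold \<Rightarrow> ('a \<Rightarrow> 'e \<Rightarrow> 'e)
     \<Rightarrow> ('b \<Rightarrow> 'a) \<Rightarrow> bool" where
  "holomorphic_submanifold N M J F \<longleftrightarrow>
     (\<forall>p\<in>points N. J (F p) ` tangent_image N M F p \<subseteq> tangent_image N M F p)"

definition totally_real_submanifold ::
    "('b, 'f::euclidean_space) manifold \<Rightarrow> ('a, 'e::euclidean_space) manifold \<Rightarrow> ('a \<Rightarrow> 'e \<Rightarrow> 'e)
     \<Rightarrow> ('a \<Rightarrow> 'e \<Rightarrow> 'e \<Rightarrow> real) \<Rightarrow> ('b \<Rightarrow> 'a) \<Rightarrow> bool" where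
  "totally_real_submanifold N M J g F \<longleftrightarrow>
     (\<forall>p\<in>points N. \<forall>V\<in>tangent_image N M F p. \<forall>U\<in>tangent_image N M F p. g (F p) (J (F p) V) U = 0)"


section \<open>Biwarped products\<close>

abbreviation prod3_manifold ::
    "('a, 'e) manifold \<Rightarrow> ('b, 'f) manifold \<Rightarrow> ('c, 'h) manifold
     \<Rightarrow> ('a \<times> 'b \<times> 'c, 'e \<times> 'f \<times> 'h) manifold" where
  "prod3_manifold M0 M1 M2 \<equiv> prod_manifold M0 (prod_manifold M1 M2)"

definition pullback_form ::
    "('a, 'e::euclidean_space) manifold \<Rightarrow> ('b, 'f::euclidean_space) manifold \<Rightarrow> ('a \<Rightarrow> 'b)
     \<Rightarrow> ('b \<Rightarrow> 'f \<Rightarrow> 'f \<Rightarrow> real) \<Rightarrow> 'a \<Rightarrow> 'e \<Rightarrow> 'e \<Rightarrow> real" where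
  "pullback_form M N F g p u v = g (F p) (differential M N F p u) (differential M N F p v)"

definition biwarped_metric ::
    "('a, 'e::euclidean_space) manifold \<Rightarrow> ('a \<Rightarrow> 'e \<Rightarrow> 'e \<Rightarrow> real)
     \<Rightarrow> ('b, 'f::euclidean_space) manifold \<Rightarrow> ('b \<Rightarrow> 'f \<Rightarrow> 'f \<Rightarrow> real)
     \<Rightarrow> ('c, 'h::euclidean_space) manifold \<Rightarrow> ('c \<Rightarrow> 'h \<Rightarrow> 'h \<Rightarrow> real)
     \<Rightarrow> ('a \<Rightarrow> real) \<Rightarrow> ('a \<Rightarrow> real)
     \<Rightarrow> 'a \<times> 'b \<times> 'c \<Rightarrow> 'e \<times> 'f \<times> 'h \<Rightarrow> 'e \<times> 'f \<times> 'h \<Rightarrow> real" where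
  "biwarped_metric M0 g0 M1 g1 M2 g2 f1 f2 x u v =
     (let M = prod3_manifold M0 M1 M2; pr0 = fst; pr1 = fst \<circ> snd; pr2 = snd \<circ> snd
      in pullback_form M M0 pr0 g0 x u v
         + (f1 (pr0 x))\<^sup>2 * pullback_form M M1 pr1 g1 x u v
         + (f2 (pr0 x))\<^sup>2 * pullback_form M M2 pr2 g2 x u v)"

definition warping_function :: "('a, 'e::euclidean_space) manifold \<Rightarrow> ('a \<Rightarrow> real) \<Rightarrow> bool" where
  "warping_function M f \<longleftrightarrow> smooth_fun M (points M) f \<and> (\<forall>p\<in>points M. f p > 0)"

definition biwarped_product_submanifold ::
    "('a, 'e::euclidean_space) manifold \<Rightarrow> ('a \<Rightarrow> 'e \<Rightarrow> 'e \<Rightarrow> real)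
     \<Rightarrow> ('b, 'f::euclidean_space) manifold \<Rightarrow> ('b \<Rightarrow> 'f \<Rightarrow> 'f \<Rightarrow> real)
     \<Rightarrow> ('c, 'h::euclidean_space) manifold \<Rightarrow> ('c \<Rightarrow> 'h \<Rightarrow> 'h \<Rightarrow> real)
     \<Rightarrow> ('a \<Rightarrow> real) \<Rightarrow> ('a \<Rightarrow> real)
     \<Rightarrow> ('m, 'k::euclidean_space) manifold \<Rightarrow> ('m \<Rightarrow> 'k \<Rightarrow> 'k \<Rightarrow> real) \<Rightarrow> ('a \<times> 'b \<times> 'c \<Rightarrow> 'm) \<Rightarrow> bool" where
  "biwarped_product_submanifold M0 g0 M1 g1 M2 g2 f1 f2 M g F \<longleftrightarrow>
     riemannian_manifold M0 g0 \<and> riemannian_manifold M1 g1 \<and> riemannian_manifold M2 g2 \<and>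
     warping_function M0 f1 \<and> warping_function M0 f2 \<and>
     isometric_immersion (prod3_manifold M0 M1 M2) (biwarped_metric M0 g0 M1 g1 M2 g2 f1 f2) M g F"

text \<open>In a biwarped product \<open>M_T x_f M_slant x_sigma M_perp\<close> in a Kaehler manifold, with factors
  embedded as a holomorphic, a proper slant and a totally real submanifold, only \<open>f\<close> is forced to be
  constant.  In complex 4-space, \<open>F(z, (a, b), t) = (z cos t, z sin t, a + i b cos phi, b sin phi)\<close>,
  with \<open>z \<noteq> 0\<close>, induces \<open>|dz|^2 + da^2 + db^2 + |z|^2 dt^2\<close>: here \<open>f = 1\<close> and
  \<open>sigma = |z|\<close>.  Constancy of \<open>f\<close> excludes every biwarped product with non-constant \<open>f\<close>, in
  particular those in which both warping functions are non-constant.\<close>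

end

theory Submission
  imports Defs
begin

text \<open>The Kaehler form \<open>\<Omega>(u, v) = g (J u) v\<close> is closed, hence so is \<open>F\<^sup>*\<Omega>\<close>.  Since
  \<open>M_T\<close> is holomorphic and orthogonal to \<open>M_slant\<close>, the mixed components of \<open>F\<^sup>*\<Omega>\<close> on
  \<open>M_T \<times> M_slant\<close> vanish, and closedness then says that the restriction of \<open>F\<^sup>*\<Omega>\<close> to
  \<open>{p} \<times> M_slant\<close> does not depend on \<open>p\<close>.  If \<open>A\<close> represents \<open>F\<^sup>*\<Omega>(z, \<cdot>)\<close> with respect to
  \<open>g_slant\<close>, the tangential part of \<open>J z\<close> is \<open>A / f\<^sup>2\<close>, and the slant condition reads
  \<open>g_slant A A = cos\<^sup>2 \<phi> f\<^sup>4 g_slant z z\<close>; so \<open>f\<close> is constant.\<close>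


section \<open>Calculus of \<open>Ck_on\<close> and symmetry of second derivatives\<close>

text \<open>A tangent vector is stored by its components in a chart picked arbitrarily at its base
  point, so vectors such as \<open>D_S p q r v\<close> need not vary continuously with
  \<open>p\<close>. Only scalars built from them can be differentiated, and only after all vectors
  near a point have been rewritten in one fixed chart. \<open>coord_field\<close> does this in the
  ambient manifold, \<open>chart_deriv\<close> for maps. The exterior derivative appears only
  through its value on three constant vectors of a chart: closedness is the vanishing of the cyclic
  sum of directional derivatives of the components. Carrying this identity through an immersion
  produces second derivatives, whose symmetry makes them cancel; this is the purpose of the calculus
  with \<open>Ck_on\<close>. The other hypotheses enter at the end: connectedness of
  \<open>M_T\<close> turns a vanishing derivative into equality at any two points,
  \<open>cos \<phi> \<noteq> 0\<close> allows the cancellation, and positivity of \<open>f\<close>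
  allows the fourth root.\<close>

lemma frechet_derivative_basis:
  fixes f :: "'a::euclidean_space \<Rightarrow> 'b::real_normed_vector"
  assumes "f differentiable (at x)"
  shows "frechet_derivative f (at x) v = (\<Sum>i\<in>Basis. (v \<bullet> i) *\<^sub>R frechet_derivative f (at x) i)"
proof -
  interpret linear "frechet_derivative f (at x)"
    using assms by (rule linear_frechet_derivative)
  have "frechet_derivative f (at x) v = frechet_derivative f (at x) (\<Sum>i\<in>Basis. (v \<bullet> i) *\<^sub>R i)"
    by (simp add: euclidean_representation)
  then show ?thesis by (simp add: sum scale)
qed

lemma frechet_derivative_cong:
  assumes "open S" "x \<in> S" "\<And>y. y \<in> S \<Longrightarrow> f y = g y" "f differentiable (at x)"
  shows "g differentiable (at x)" "frechet_derivative g (at x) = frechet_derivative f (at x)"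
proof -
  have "(g has_derivative frechet_derivative f (at x)) (at x)"
    using assms frechet_derivative_works has_derivative_transform_within_open by blast
  then show "g differentiable (at x)" "frechet_derivative g (at x) = frechet_derivative f (at x)"
    by (auto simp: differentiable_def dest: frechet_derivative_at[symmetric])
qed

lemma Ck_on_cong:
  assumes "open S" "\<And>x. x \<in> S \<Longrightarrow> f x = g x" "Ck_on k S f"
  shows "Ck_on k S g"
  using assms(2,3)
proof (induction k arbitrary: f g)
  case 0
  then show ?case by (simp cong: continuous_on_cong)
next
  case (Suc k)
  have "Ck_on k S (\<lambda>x. frechet_derivative g (at x) v)" for v
  proof (rule Suc.IH)
    show "Ck_on k S (\<lambda>x. frechet_derivative f (at x) v)" using Suc.prems by simp
    show "frechet_derivative f (at x) v = frechet_derivative g (at x) v" if "x \<in> S" for x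
      using frechet_derivative_cong(2)[OF assms(1) that Suc.prems(1)] Suc.prems(2) that by simp
  qed
  then show ?case using frechet_derivative_cong(1)[OF assms(1) _ Suc.prems(1)] Suc.prems(2) by simp
qed

lemma Ck_on_SucD: "Ck_on (Suc k) S f \<Longrightarrow> Ck_on k S f"
proof (induction k arbitrary: f)
  case 0
  then have "f differentiable_on S"
    unfolding differentiable_on_def by (simp add: differentiable_at_withinI)
  then show ?case by (simp add: differentiable_imp_continuous_on)
next
  case (Suc k)
  then show ?case by (metis Ck_on.simps(2))
qed

lemma Ck_on_differentiable: "Ck_on (Suc k) S f \<Longrightarrow> x \<in> S \<Longrightarrow> f differentiable (at x)"
  by simp

lemma Ck_on_has_derivative:
  "Ck_on (Suc k) S f \<Longrightarrow> x \<in> S \<Longrightarrow> (f has_derivative frechet_derivative f (at x)) (at x)"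
  by (simp add: frechet_derivative_works)

lemma Ck_on_const: "Ck_on k S (\<lambda>x. c)"
  by (induction k arbitrary: c) auto

text \<open>Interface for the inductions on \<open>k\<close> below: it suffices to exhibit some
  derivative, without computing \<open>frechet_derivative\<close> of a compound term.\<close>

lemma Ck_on_Suc_intro:
  assumes "open S" "\<And>x. x \<in> S \<Longrightarrow> (f has_derivative f' x) (at x)" "\<And>v. Ck_on k S (\<lambda>x. f' x v)"
  shows "Ck_on (Suc k) S f"
proof -
  have "Ck_on k S (\<lambda>x. frechet_derivative f (at x) v)" for v
    by (rule Ck_on_cong[OF assms(1) _ assms(3)]) (simp add: frechet_derivative_at[OF assms(2)])
  then show ?thesis using assms(2) by (auto simp: differentiable_def)
qed

lemma Ck_on_linear:
  assumes "bounded_linear L" "open S" "Ck_on k S f"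
  shows "Ck_on k S (\<lambda>x. L (f x))"
  using assms(3)
proof (induction k arbitrary: f)
  case 0
  then show ?case using assms(1) by (simp add: bounded_linear.continuous_on)
next
  case (Suc k)
  show ?case
  proof (rule Ck_on_Suc_intro[OF assms(2)])
    show "((\<lambda>x. L (f x)) has_derivative (\<lambda>v. L (frechet_derivative f (at x) v))) (at x)" if "x \<in> S" for x
      using Ck_on_has_derivative[OF Suc.prems that] assms(1) by (rule bounded_linear.has_derivative[rotated])
    show "Ck_on k S (\<lambda>x. L (frechet_derivative f (at x) v))" for v
      using Suc by simp
  qed
qed

lemma Ck_on_add:
  assumes "open S" "Ck_on k S f" "Ck_on k S g"
  shows "Ck_on k S (\<lambda>x. f x + g x)"
  using assms(2,3)
proof (induction k arbitrary: f g)
  case 0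
  then show ?case by (simp add: continuous_on_add)
next
  case (Suc k)
  show ?case
  proof (rule Ck_on_Suc_intro[OF assms(1)])
    show "((\<lambda>x. f x + g x) has_derivative
        (\<lambda>v. frechet_derivative f (at x) v + frechet_derivative g (at x) v)) (at x)" if "x \<in> S" for x
      using Ck_on_has_derivative[OF Suc.prems(1) that] Ck_on_has_derivative[OF Suc.prems(2) that]
      by (rule has_derivative_add)
    show "Ck_on k S (\<lambda>x. frechet_derivative f (at x) v + frechet_derivative g (at x) v)" for v
      using Suc by simp
  qed
qed

lemma Ck_on_sum:
  assumes "open S" "finite I" "\<And>i. i \<in> I \<Longrightarrow> Ck_on k S (f i)"
  shows "Ck_on k S (\<lambda>x. \<Sum>i\<in>I. f i x)"
  using assms(2,3)
  by (induction I rule: finite_induct) (auto intro!: Ck_on_add assms(1) Ck_on_const)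

lemma Ck_on_scaleR:
  assumes "open S" "Ck_on k S a" "Ck_on k S f"
  shows "Ck_on k S (\<lambda>x. a x *\<^sub>R f x)"
  using assms(2,3)
proof (induction k arbitrary: a f)
  case 0
  then show ?case by (simp add: continuous_on_scaleR)
next
  case (Suc k)
  show ?case
  proof (rule Ck_on_Suc_intro[OF assms(1)])
    show "((\<lambda>x. a x *\<^sub>R f x) has_derivative
        (\<lambda>v. a x *\<^sub>R frechet_derivative f (at x) v + frechet_derivative a (at x) v *\<^sub>R f x)) (at x)"
      if "x \<in> S" for x
      using Ck_on_has_derivative[OF Suc.prems(1) that] Ck_on_has_derivative[OF Suc.prems(2) that]
      by (rule has_derivative_scaleR)
    show "Ck_on k S (\<lambda>x. a x *\<^sub>R frechet_derivative f (at x) v + frechet_derivative a (at x) v *\<^sub>R f x)" for v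
      using Suc.prems Ck_on_SucD[OF Suc.prems(1)] Ck_on_SucD[OF Suc.prems(2)]
      by (intro Ck_on_add assms(1) Suc.IH) auto
  qed
qed

text \<open>The chain rule yields the derivative of \<open>f\<close> in a direction that varies with
  \<open>x\<close>, whereas \<open>Ck_on\<close> speaks of fixed directions. Expanding that
  direction in the basis leaves sums of products, and the induction hypothesis is applied to the
  partial derivatives of \<open>f\<close> with the same inner map \<open>g\<close>.\<close>

lemma Ck_on_compose:
  fixes g :: "'a::euclidean_space \<Rightarrow> 'b::euclidean_space" and f :: "'b \<Rightarrow> 'c::euclidean_space"
  assumes "open S" "open T" "g ` S \<subseteq> T" "Ck_on k S g" "Ck_on k T f"
  shows "Ck_on k S (\<lambda>x. f (g x))"
  using assms(4,5)
proof (induction k arbitrary: f)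
  case 0
  then show ?case using assms(3) by (auto intro: continuous_on_compose2)
next
  case (Suc k)
  have g: "Ck_on k S g" by (rule Ck_on_SucD[OF Suc.prems(1)])
  have gT: "g x \<in> T" if "x \<in> S" for x using assms(3) that by blast
  show ?case
  proof (rule Ck_on_Suc_intro[OF assms(1)])
    show "((\<lambda>x. f (g x)) has_derivative
        (\<lambda>v. \<Sum>i\<in>Basis. (frechet_derivative g (at x) v \<bullet> i) *\<^sub>R frechet_derivative f (at (g x)) i)) (at x)"
      if "x \<in> S" for x
    proof -
      have "((\<lambda>x. f (g x)) has_derivative (\<lambda>v. frechet_derivative f (at (g x)) (frechet_derivative g (at x) v))) (at x)"
        using has_derivative_compose Ck_on_has_derivative[OF Suc.prems(1) that]
          Ck_on_has_derivative[OF Suc.prems(2) gT[OF that]] by blast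
      then show ?thesis
        by (subst (asm) frechet_derivative_basis[OF Ck_on_differentiable[OF Suc.prems(2) gT[OF that]]])
    qed
    show "Ck_on k S (\<lambda>x. \<Sum>i\<in>Basis. (frechet_derivative g (at x) v \<bullet> i) *\<^sub>R frechet_derivative f (at (g x)) i)" for v
    proof (intro Ck_on_sum Ck_on_scaleR assms(1))
      show "Ck_on k S (\<lambda>x. frechet_derivative g (at x) v \<bullet> i)" for i
        using Suc.prems(1) by (auto intro: Ck_on_linear[OF bounded_linear_inner_left] assms(1))
      show "Ck_on k S (\<lambda>x. frechet_derivative f (at (g x)) i)" for i
        using Suc.prems(2) by (intro Suc.IH g) simp
    qed auto
  qed
qed

text \<open>The second difference of \<open>\<psi>\<close> over the parallelogram spanned by \<open>t *\<^sub>R u\<close>, \<open>t *\<^sub>R v\<close> is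
  symmetric in \<open>u\<close>, \<open>v\<close>; two applications of the mean value theorem turn it into
  \<open>t\<^sup>2\<close> times a mixed second derivative at a nearby point.\<close>

lemma second_difference_mvt:
  fixes \<psi> :: "'a::euclidean_space \<Rightarrow> real"
  assumes U: "ball x e \<subseteq> U" and C2: "Ck_on 2 U \<psi>"
    and t: "0 < t" "t * (norm u + norm v) < e"
  obtains y where "norm (y - x) \<le> t * (norm u + norm v)"
    "\<psi> (x + t *\<^sub>R u + t *\<^sub>R v) - \<psi> (x + t *\<^sub>R u) - \<psi> (x + t *\<^sub>R v) + \<psi> x =
     t * t * frechet_derivative (\<lambda>z. frechet_derivative \<psi> (at z) u) (at y) v"
proof -
  have C2': "Ck_on (Suc (Suc 0)) U \<psi>" using C2 by (simp only: numeral_2_eq_2)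
  have bd: "norm (a *\<^sub>R u + b *\<^sub>R v) \<le> t * (norm u + norm v)" if "0 \<le> a" "a \<le> t" "0 \<le> b" "b \<le> t" for a b
  proof -
    have "norm (a *\<^sub>R u + b *\<^sub>R v) \<le> a * norm u + b * norm v"
      using norm_triangle_ineq[of "a *\<^sub>R u" "b *\<^sub>R v"] that by simp
    also have "\<dots> \<le> t * norm u + t * norm v"
      using that by (intro add_mono mult_right_mono) auto
    finally show ?thesis by (simp add: distrib_left)
  qed
  have inU: "x + a *\<^sub>R u + b *\<^sub>R v \<in> U" if "0 \<le> a" "a \<le> t" "0 \<le> b" "b \<le> t" for a b
  proof -
    have "dist x (x + (a *\<^sub>R u + b *\<^sub>R v)) < e"
      using bd[OF that] t by (metis add_diff_cancel_left' dist_commute dist_norm le_less_trans)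
    then show ?thesis using U by (auto simp: add.assoc)
  qed
  define D where "D z = frechet_derivative \<psi> (at z)" for z
  have d1: "((\<lambda>s. \<psi> (x + s *\<^sub>R u + b *\<^sub>R v)) has_derivative (\<lambda>h. h * D (x + a *\<^sub>R u + b *\<^sub>R v) u)) (at a)"
    if "0 \<le> a" "a \<le> t" "0 \<le> b" "b \<le> t" for a b
  proof -
    have D: "(\<psi> has_derivative D (x + a *\<^sub>R u + b *\<^sub>R v)) (at (x + a *\<^sub>R u + b *\<^sub>R v))"
      unfolding D_def by (rule Ck_on_has_derivative[OF C2' inU[OF that]])
    have "((\<lambda>s. x + s *\<^sub>R u + b *\<^sub>R v) has_derivative (\<lambda>h. h *\<^sub>R u)) (at a)"
      by (auto intro!: derivative_eq_intros)
    from has_derivative_compose[OF this D] show ?thesis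
      using has_derivative_linear[OF D] by (simp add: linear_cmul)
  qed
  \<comment> \<open>Mean value theorem along \<open>u\<close>, for the difference of \<psi> between
    the two sides of the parallelogram parallel to \<open>u\<close>. The term
    \<open>0 *\<^sub>R v\<close> keeps both sides in the shape of \<open>d1\<close>.\<close>
  have "((\<lambda>s. \<psi> (x + s *\<^sub>R u + t *\<^sub>R v) - \<psi> (x + s *\<^sub>R u + 0 *\<^sub>R v)) has_derivative
      (\<lambda>h. h * D (x + a *\<^sub>R u + t *\<^sub>R v) u - h * D (x + a *\<^sub>R u + 0 *\<^sub>R v) u)) (at a within {0..t})"
    if "0 \<le> a" "a \<le> t" for a
    by (rule has_derivative_at_withinI, rule has_derivative_diff; rule d1) (use that t in auto)
  then have "\<exists>s\<in>{0<..<t}. (\<psi> (x + t *\<^sub>R u + t *\<^sub>R v) - \<psi> (x + t *\<^sub>R u + 0 *\<^sub>R v)) -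
      (\<psi> (x + 0 *\<^sub>R u + t *\<^sub>R v) - \<psi> (x + 0 *\<^sub>R u + 0 *\<^sub>R v)) =
      (t - 0) * D (x + s *\<^sub>R u + t *\<^sub>R v) u - (t - 0) * D (x + s *\<^sub>R u + 0 *\<^sub>R v) u"
    by (rule mvt_simple[OF t(1)])
  then obtain s where s': "s \<in> {0<..<t}" and
    e1': "(\<psi> (x + t *\<^sub>R u + t *\<^sub>R v) - \<psi> (x + t *\<^sub>R u + 0 *\<^sub>R v)) -
      (\<psi> (x + 0 *\<^sub>R u + t *\<^sub>R v) - \<psi> (x + 0 *\<^sub>R u + 0 *\<^sub>R v)) =
      (t - 0) * D (x + s *\<^sub>R u + t *\<^sub>R v) u - (t - 0) * D (x + s *\<^sub>R u + 0 *\<^sub>R v) u" ..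
  from s' have s: "0 < s" "s < t" by auto
  have e1: "\<psi> (x + t *\<^sub>R u + t *\<^sub>R v) - \<psi> (x + t *\<^sub>R u) - \<psi> (x + t *\<^sub>R v) + \<psi> x =
      t * (D (x + s *\<^sub>R u + t *\<^sub>R v) u - D (x + s *\<^sub>R u) u)"
    using e1' by (simp add: right_diff_distrib)
  \<comment> \<open>With \<open>s\<close> frozen, the remaining difference of \<open>D _ u\<close>
    is taken along \<open>v\<close>; this gives the second application.\<close>
  have d2: "((\<lambda>r. D (x + s *\<^sub>R u + r *\<^sub>R v) u) has_derivative
      (\<lambda>h. h * frechet_derivative (\<lambda>z. D z u) (at (x + s *\<^sub>R u + b *\<^sub>R v)) v)) (at b)"
    if "0 \<le> b" "b \<le> t" for b
  proof -
    have "Ck_on (Suc 0) U (\<lambda>z. D z u)" using C2' unfolding D_def by simp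
    then have D: "((\<lambda>z. D z u) has_derivative frechet_derivative (\<lambda>z. D z u) (at (x + s *\<^sub>R u + b *\<^sub>R v)))
        (at (x + s *\<^sub>R u + b *\<^sub>R v))"
      by (rule Ck_on_has_derivative) (use s that inU in auto)
    have "((\<lambda>r. x + s *\<^sub>R u + r *\<^sub>R v) has_derivative (\<lambda>h. h *\<^sub>R v)) (at b)"
      by (auto intro!: derivative_eq_intros)
    from has_derivative_compose[OF this D] show ?thesis
      using has_derivative_linear[OF D] by (simp add: linear_cmul)
  qed
  have "\<exists>r\<in>{0<..<t}. D (x + s *\<^sub>R u + t *\<^sub>R v) u - D (x + s *\<^sub>R u + 0 *\<^sub>R v) u =
      (t - 0) * frechet_derivative (\<lambda>z. D z u) (at (x + s *\<^sub>R u + r *\<^sub>R v)) v"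
    by (rule mvt_simple[OF t(1)]) (rule has_derivative_at_withinI[OF d2])
  then obtain r where r': "r \<in> {0<..<t}" and
    e2': "D (x + s *\<^sub>R u + t *\<^sub>R v) u - D (x + s *\<^sub>R u + 0 *\<^sub>R v) u =
      (t - 0) * frechet_derivative (\<lambda>z. D z u) (at (x + s *\<^sub>R u + r *\<^sub>R v)) v" ..
  from r' have r: "0 < r" "r < t" by auto
  have e2: "D (x + s *\<^sub>R u + t *\<^sub>R v) u - D (x + s *\<^sub>R u) u =
      t * frechet_derivative (\<lambda>z. D z u) (at (x + s *\<^sub>R u + r *\<^sub>R v)) v"
    using e2' by simp
  show thesis
  proof (rule that)
    show "norm (x + s *\<^sub>R u + r *\<^sub>R v - x) \<le> t * (norm u + norm v)"
      using bd[of s r] s r by (simp add: algebra_simps)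
  qed (use e1 e2 in \<open>simp add: D_def mult.assoc\<close>)
qed

text \<open>Both orders of differentiation compute the same second difference, so the two mixed
  derivatives agree at two points \<open>y\<close>, \<open>y'\<close> that may differ but are both
  close to \<open>x\<close>. Continuity of the mixed derivatives then makes them equal at
  \<open>x\<close> up to any \<epsilon>.\<close>

lemma second_derivative_symmetric_real:
  fixes \<psi> :: "'a::euclidean_space \<Rightarrow> real"
  assumes "open U" "x \<in> U" and C2: "Ck_on 2 U \<psi>"
  shows "frechet_derivative (\<lambda>z. frechet_derivative \<psi> (at z) u) (at x) v =
         frechet_derivative (\<lambda>z. frechet_derivative \<psi> (at z) v) (at x) u"
proof -
  obtain e where e: "0 < e" "ball x e \<subseteq> U" using assms by (meson openE)
  define H where "H a b z = frechet_derivative (\<lambda>z. frechet_derivative \<psi> (at z) a) (at z) b" for a b z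
  have cont: "continuous_on U (H a b)" for a b
    using C2 unfolding H_def by (simp add: numeral_2_eq_2)
  have lim: "(H a b \<longlongrightarrow> H a b x) (at x)" for a b
    using continuous_on_eq_continuous_at[OF assms(1)] cont assms(2) isCont_def by blast
  \<comment> \<open>The summand 1 keeps the divisor in the choice of \<open>t\<close> positive even
    when \<open>u\<close> and \<open>v\<close> both vanish.\<close>
  define c where "c = norm u + norm v + 1"
  have c: "c > 0" unfolding c_def by (simp add: add_nonneg_pos)
  have "\<bar>H u v x - H v u x\<bar> \<le> \<epsilon>" if "\<epsilon> > 0" for \<epsilon>
  proof -
    have "\<forall>\<^sub>F y in nhds x. dist (H u v y) (H u v x) < \<epsilon> / 2 \<and> dist (H v u y) (H v u x) < \<epsilon> / 2"
      using tendstoD[OF lim[of u v, unfolded tendsto_at_iff_tendsto_nhds], of "\<epsilon> / 2"]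
        tendstoD[OF lim[of v u, unfolded tendsto_at_iff_tendsto_nhds], of "\<epsilon> / 2"] that
      by (intro eventually_conj) simp_all
    then obtain d where d: "d > 0" "\<And>y. dist y x < d \<Longrightarrow> dist (H u v y) (H u v x) < \<epsilon> / 2 \<and> dist (H v u y) (H v u x) < \<epsilon> / 2"
      by (auto simp: eventually_nhds_metric)
    define t where "t = min d e / (2 * c)"
    have t: "t > 0" unfolding t_def using d e c by simp
    have tc: "t * c = min d e / 2" unfolding t_def using c by simp
    have small: "t * (norm u + norm v) < min d e"
    proof -
      have "t * (norm u + norm v) \<le> t * c" using t by (simp add: c_def)
      also have "\<dots> < min d e" using tc d(1) e(1) by linarith
      finally show ?thesis .
    qed
    obtain y where y: "norm (y - x) \<le> t * (norm u + norm v)"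
      "\<psi> (x + t *\<^sub>R u + t *\<^sub>R v) - \<psi> (x + t *\<^sub>R u) - \<psi> (x + t *\<^sub>R v) + \<psi> x = t * t * H u v y"
      using second_difference_mvt[OF e(2) C2 t, of u v] small unfolding H_def by auto
    obtain y' where y': "norm (y' - x) \<le> t * (norm v + norm u)"
      "\<psi> (x + t *\<^sub>R v + t *\<^sub>R u) - \<psi> (x + t *\<^sub>R v) - \<psi> (x + t *\<^sub>R u) + \<psi> x = t * t * H v u y'"
      using second_difference_mvt[OF e(2) C2 t, of v u] small unfolding H_def by (auto simp: add.commute)
    have eq: "x + t *\<^sub>R v + t *\<^sub>R u = x + t *\<^sub>R u + t *\<^sub>R v" by simp
    have "t * t * H u v y = t * t * H v u y'"
      using y(2) y'(2) unfolding eq by linarith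
    then have "H u v y = H v u y'" using t by simp
    moreover have "dist y x < d" "dist y' x < d"
      using y(1) y'(1) small by (auto simp: dist_norm add.commute)
    ultimately show ?thesis using d(2)[of y] d(2)[of y'] unfolding dist_real_def by linarith
  qed
  then have "H u v x = H v u x" by (metis abs_le_zero_iff dense_ge eq_iff_diff_eq_0)
  then show ?thesis unfolding H_def .
qed

text \<open>Componentwise, since the mean value theorem behind the real case fails for vector-valued
  maps.\<close>

lemma second_derivative_symmetric:
  fixes f :: "'a::euclidean_space \<Rightarrow> 'b::euclidean_space"
  assumes "open U" "x \<in> U" and C2: "Ck_on 2 U f"
  shows "frechet_derivative (\<lambda>z. frechet_derivative f (at z) u) (at x) v =
         frechet_derivative (\<lambda>z. frechet_derivative f (at z) v) (at x) u"
proof (rule euclidean_eqI)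
  fix i :: 'b assume "i \<in> Basis"
  have C2': "Ck_on (Suc (Suc 0)) U f" using C2 by (simp only: numeral_2_eq_2)
  have comp: "frechet_derivative (\<lambda>z. g z \<bullet> i) (at y) w = frechet_derivative g (at y) w \<bullet> i"
    if "g differentiable (at y)" for g :: "'a \<Rightarrow> 'b" and y w
  proof -
    have "((\<lambda>z. g z \<bullet> i) has_derivative (\<lambda>w. frechet_derivative g (at y) w \<bullet> i)) (at y)"
      using that by (auto simp: frechet_derivative_works intro: has_derivative_inner_left)
    then show ?thesis by (metis frechet_derivative_at)
  qed
  have *: "frechet_derivative (\<lambda>z. frechet_derivative (\<lambda>z. f z \<bullet> i) (at z) a) (at x) b =
      frechet_derivative (\<lambda>z. frechet_derivative f (at z) a) (at x) b \<bullet> i" for a b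
  proof -
    have d: "(\<lambda>z. frechet_derivative f (at z) a) differentiable (at x)"
      using C2' assms(2) by simp
    have "frechet_derivative (\<lambda>z. frechet_derivative (\<lambda>z. f z \<bullet> i) (at z) a) (at x) =
      frechet_derivative (\<lambda>z. frechet_derivative f (at z) a \<bullet> i) (at x)"
    proof (rule frechet_derivative_cong(2)[OF assms(1,2)])
      show "frechet_derivative f (at y) a \<bullet> i = frechet_derivative (\<lambda>z. f z \<bullet> i) (at y) a" if "y \<in> U" for y
        using comp[OF Ck_on_differentiable[OF C2' that]] by simp
      show "(\<lambda>z. frechet_derivative f (at z) a \<bullet> i) differentiable (at x)"
        using d by (auto simp: differentiable_def intro: has_derivative_inner_left)
    qed
    then show ?thesis using comp[OF d] by simp
  qed
  have "Ck_on 2 U (\<lambda>z. f z \<bullet> i)"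
    by (rule Ck_on_linear[OF bounded_linear_inner_left assms(1) C2])
  from second_derivative_symmetric_real[OF assms(1,2) this, of u v]
  show "frechet_derivative (\<lambda>z. frechet_derivative f (at z) u) (at x) v \<bullet> i =
      frechet_derivative (\<lambda>z. frechet_derivative f (at z) v) (at x) u \<bullet> i"
    unfolding * .
qed


section \<open>Derivatives of maps between manifolds in charts\<close>

text \<open>The part of \<^const>\<open>smooth_manifold\<close> that concerns single charts; the calculus below is
  pointwise, so products need no more than this.\<close>

definition charted :: "('a, 'e::euclidean_space) manifold \<Rightarrow> bool" where
  "charted M \<longleftrightarrow>
     (\<Union>c\<in>atlas M. fst c) = points M \<and>
     (\<forall>c\<in>atlas M. openin (mtop M) (fst c) \<and> open (snd c ` fst c) \<and>
        homeomorphic_map (subtopology (mtop M) (fst c)) (top_of_set (snd c ` fst c)) (snd c))"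

lemma smooth_manifold_charted: "smooth_manifold M \<Longrightarrow> charted M"
  unfolding smooth_manifold_def charted_def by auto

section \<open>Charts as homeomorphisms onto open sets\<close>

lemma charted_chart:
  assumes "charted M" "c \<in> atlas M"
  shows "openin (mtop M) (fst c)" "open (snd c ` fst c)" "fst c \<subseteq> points M"
    "homeomorphic_map (subtopology (mtop M) (fst c)) (top_of_set (snd c ` fst c)) (snd c)"
  using assms openin_subset unfolding charted_def by blast+

lemma topspace_chart_domain:
  assumes "charted M" "c \<in> atlas M"
  shows "topspace (subtopology (mtop M) (fst c)) = fst c"
  using charted_chart(3)[OF assms] by auto

lemma chart_inj_on:
  assumes "charted M" "c \<in> atlas M"
  shows "inj_on (snd c) (fst c)"
  using homeomorphic_imp_injective_map[OF charted_chart(4)[OF assms]] topspace_chart_domain[OF assms]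
  by simp

lemma chart_inv_left:
  assumes "charted M" "c \<in> atlas M" "p \<in> fst c"
  shows "chart_inv c (snd c p) = p"
  unfolding chart_inv_def by (rule inv_into_f_f[OF chart_inj_on[OF assms(1,2)] assms(3)])

lemma chart_inv_right: "y \<in> snd c ` fst c \<Longrightarrow> snd c (chart_inv c y) = y"
  unfolding chart_inv_def by (rule f_inv_into_f)

lemma chart_inv_in: "y \<in> snd c ` fst c \<Longrightarrow> chart_inv c y \<in> fst c"
  unfolding chart_inv_def by (rule inv_into_into)

lemma chart_inv_image_in:
  assumes "charted M" "c \<in> atlas M" "y \<in> snd c ` (fst c \<inter> W)"
  shows "chart_inv c y \<in> fst c" "chart_inv c y \<in> W" "snd c (chart_inv c y) = y"
  using assms chart_inv_left[OF assms(1,2)] by auto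

lemma open_chart_image:
  assumes "charted M" "c \<in> atlas M" "openin (mtop M) W"
  shows "open (snd c ` (fst c \<inter> W))"
proof -
  have "openin (subtopology (mtop M) (fst c)) (fst c \<inter> W)"
    using assms(3) by (auto simp: openin_subtopology)
  then have "openin (top_of_set (snd c ` fst c)) (snd c ` (fst c \<inter> W))"
    using homeomorphic_imp_open_map[OF charted_chart(4)[OF assms(1,2)]] by (simp add: open_map_def)
  then show ?thesis
    using charted_chart(2)[OF assms(1,2)] by (simp add: openin_open_eq)
qed

lemma openin_chart_inv_image:
  assumes "charted M" "c \<in> atlas M" "open V" "V \<subseteq> snd c ` fst c"
  shows "openin (mtop M) (chart_inv c ` V)"
proof -
  have "continuous_map (subtopology (mtop M) (fst c)) (top_of_set (snd c ` fst c)) (snd c)"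
    by (rule homeomorphic_imp_continuous_map[OF charted_chart(4)[OF assms(1,2)]])
  moreover have "openin (top_of_set (snd c ` fst c)) V"
    using assms(3,4) charted_chart(2)[OF assms(1,2)] by (simp add: openin_open_eq)
  ultimately have "openin (subtopology (mtop M) (fst c)) {p \<in> fst c. snd c p \<in> V}"
    by (rule openin_continuous_map_preimage[where Y = "top_of_set (snd c ` fst c)",
          of "subtopology (mtop M) (fst c)", unfolded topspace_chart_domain[OF assms(1,2)]])
  moreover have "{p \<in> fst c. snd c p \<in> V} = chart_inv c ` V"
  proof
    show "{p \<in> fst c. snd c p \<in> V} \<subseteq> chart_inv c ` V"
      using chart_inv_left[OF assms(1,2)] by (metis (mono_tags, lifting) imageI mem_Collect_eq subsetI)
    show "chart_inv c ` V \<subseteq> {p \<in> fst c. snd c p \<in> V}"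
      by (auto simp: chart_inv_right[OF subsetD[OF assms(4)]] chart_inv_in[OF subsetD[OF assms(4)]])
  qed
  ultimately show ?thesis
    using charted_chart(1)[OF assms(1,2)] openin_trans_full by metis
qed

lemma chart_at:
  assumes "charted M" "p \<in> points M"
  shows "chart_at M p \<in> atlas M" "p \<in> fst (chart_at M p)"
proof -
  have "\<exists>c. c \<in> atlas M \<and> p \<in> fst c" using assms unfolding charted_def by blast
  from someI_ex[OF this] show "chart_at M p \<in> atlas M" "p \<in> fst (chart_at M p)"
    unfolding chart_at_def by auto
qed

text \<open>The Jacobian of \<open>F\<close> at \<open>p\<close> in freely chosen charts.
  \<open>differential\<close> and \<open>tcoord\<close> are the cases in which charts are prescribed
  by \<open>chart_at\<close>, so one chain rule serves both, and \<open>F\<close> the identity gives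
  changes of chart.\<close>

definition chart_deriv ::
    "('a, 'e::euclidean_space) chart \<Rightarrow> ('b, 'f::euclidean_space) chart \<Rightarrow> ('a \<Rightarrow> 'b) \<Rightarrow> 'a \<Rightarrow> 'e \<Rightarrow> 'f" where
  "chart_deriv a c F p = frechet_derivative (snd c \<circ> F \<circ> chart_inv a) (at (snd a p))"

text \<open>Continuity is a separate clause because \<open>snd c\<close> is a total function:
  differentiability of the chart expression does not show that \<open>F\<close> maps a neighbourhood
  of \<open>p\<close> into the domain of \<open>c\<close>.\<close>

definition mdiff ::
    "('a, 'e::euclidean_space) manifold \<Rightarrow> ('b, 'f::euclidean_space) manifold \<Rightarrow> ('a \<Rightarrow> 'b) \<Rightarrow> 'a \<Rightarrow> bool" where
  "mdiff M N F p \<longleftrightarrow> p \<in> points M \<and> F p \<in> points N \<and>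
     (\<forall>W. openin (mtop N) W \<and> F p \<in> W \<longrightarrow> (\<exists>V. openin (mtop M) V \<and> p \<in> V \<and> F ` V \<subseteq> W)) \<and>
     (\<forall>a\<in>atlas M. \<forall>c\<in>atlas N. p \<in> fst a \<and> F p \<in> fst c \<longrightarrow>
        (snd c \<circ> F \<circ> chart_inv a) differentiable (at (snd a p)))"

lemma differential_eq_chart_deriv:
  "differential M N F p = chart_deriv (chart_at M p) (chart_at N (F p)) F p"
  unfolding differential_def chart_deriv_def coord_at_def by auto

lemma tcoord_eq_chart_deriv:
  "tcoord M c p = chart_deriv (chart_at M p) c (\<lambda>x. x) p"
  unfolding tcoord_def chart_deriv_def coord_at_def by (auto simp: comp_def)

lemma mdiff_has_derivative:
  assumes "mdiff M N F p" "a \<in> atlas M" "c \<in> atlas N" "p \<in> fst a" "F p \<in> fst c"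
  shows "((snd c \<circ> F \<circ> chart_inv a) has_derivative chart_deriv a c F p) (at (snd a p))"
  using assms unfolding mdiff_def chart_deriv_def frechet_derivative_works by blast

lemma linear_chart_deriv:
  assumes "mdiff M N F p" "a \<in> atlas M" "c \<in> atlas N" "p \<in> fst a" "F p \<in> fst c"
  shows "linear (chart_deriv a c F p)"
  using has_derivative_linear[OF mdiff_has_derivative[OF assms]] .

lemma mdiff_points: "mdiff M N F p \<Longrightarrow> p \<in> points M" "mdiff M N F p \<Longrightarrow> F p \<in> points N"
  unfolding mdiff_def by auto

lemma mdiff_cont:
  assumes "mdiff M N F p" "openin (mtop N) W" "F p \<in> W"
  obtains V where "openin (mtop M) V" "p \<in> V" "F ` V \<subseteq> W"
  using assms unfolding mdiff_def by meson

text \<open>By continuity \<open>F\<close> stays in the domain of the middle chart \<open>c\<close>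
  near \<open>p\<close>, where \<open>c\<close> and its inverse cancel. The middle chart is
  arbitrary, so this also expresses that derivatives do not depend on it.\<close>

lemma chart_deriv_compose:
  assumes M: "charted M" and N: "charted N"
    and F: "mdiff M N F p" and G: "mdiff N P G (F p)"
    and a: "a \<in> atlas M" "p \<in> fst a" and c: "c \<in> atlas N" "F p \<in> fst c"
    and d: "d \<in> atlas P" "G (F p) \<in> fst d"
  shows "((snd d \<circ> (\<lambda>x. G (F x)) \<circ> chart_inv a) has_derivative
            (\<lambda>v. chart_deriv c d G (F p) (chart_deriv a c F p v))) (at (snd a p))"
    and "chart_deriv a d (\<lambda>x. G (F x)) p v = chart_deriv c d G (F p) (chart_deriv a c F p v)"
proof -
  have 1: "((snd c \<circ> F \<circ> chart_inv a) has_derivative chart_deriv a c F p) (at (snd a p))"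
    by (rule mdiff_has_derivative[OF F a(1) c(1) a(2) c(2)])
  have "(snd c \<circ> F \<circ> chart_inv a) (snd a p) = snd c (F p)"
    by (simp add: chart_inv_left[OF M a])
  then have 2: "((snd d \<circ> G \<circ> chart_inv c) has_derivative chart_deriv c d G (F p))
      (at ((snd c \<circ> F \<circ> chart_inv a) (snd a p)))"
    using mdiff_has_derivative[OF G c(1) d(1) c(2) d(2)] by simp
  obtain V where V: "openin (mtop M) V" "p \<in> V" "F ` V \<subseteq> fst c"
    using mdiff_cont[OF F charted_chart(1)[OF N c(1)] c(2)] .
  show *: "((snd d \<circ> (\<lambda>x. G (F x)) \<circ> chart_inv a) has_derivative
            (\<lambda>v. chart_deriv c d G (F p) (chart_deriv a c F p v))) (at (snd a p))"
  proof (rule has_derivative_transform_within_open[OF has_derivative_compose[OF 1 2] open_chart_image[OF M a(1) V(1)]])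
    show "snd a p \<in> snd a ` (fst a \<inter> V)" using a V by blast
    fix y assume "y \<in> snd a ` (fst a \<inter> V)"
    then have "F (chart_inv a y) \<in> fst c" using chart_inv_image_in(2)[OF M a(1), of y V] V(3) by auto
    then show "(snd d \<circ> G \<circ> chart_inv c) ((snd c \<circ> F \<circ> chart_inv a) y) = (snd d \<circ> (\<lambda>x. G (F x)) \<circ> chart_inv a) y"
      by (simp add: chart_inv_left[OF N c(1)])
  qed
  show "chart_deriv a d (\<lambda>x. G (F x)) p v = chart_deriv c d G (F p) (chart_deriv a c F p v)"
    unfolding chart_deriv_def[of a d] using frechet_derivative_at[OF *] by metis
qed

lemma mdiff_compose:
  assumes M: "charted M" and N: "charted N" and F: "mdiff M N F p" and G: "mdiff N P G (F p)"
  shows "mdiff M P (\<lambda>x. G (F x)) p"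
  unfolding mdiff_def
proof (intro conjI allI impI ballI)
  show "p \<in> points M" "G (F p) \<in> points P" using F G unfolding mdiff_def by auto
  fix W assume "openin (mtop P) W \<and> G (F p) \<in> W"
  then obtain V where "openin (mtop N) V" "F p \<in> V" "G ` V \<subseteq> W" using mdiff_cont[OF G] by metis
  moreover from this obtain U where "openin (mtop M) U" "p \<in> U" "F ` U \<subseteq> V" using mdiff_cont[OF F] by metis
  ultimately show "\<exists>V. openin (mtop M) V \<and> p \<in> V \<and> (\<lambda>x. G (F x)) ` V \<subseteq> W" by blast
next
  fix a d assume "a \<in> atlas M" "d \<in> atlas P" "p \<in> fst a \<and> G (F p) \<in> fst d"
  then show "(snd d \<circ> (\<lambda>x. G (F x)) \<circ> chart_inv a) differentiable (at (snd a p))"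
    using chart_deriv_compose(1)[OF M N F G _ _ chart_at[OF N mdiff_points(2)[OF F]]]
    unfolding differentiable_def by blast
qed

lemma differential_compose:
  assumes "charted M" "charted N" "charted P" "mdiff M N F p" "mdiff N P G (F p)"
  shows "differential M P (\<lambda>x. G (F x)) p v = differential N P G (F p) (differential M N F p v)"
  unfolding differential_eq_chart_deriv
  by (rule chart_deriv_compose(2)[OF assms(1,2,4,5)])
     (simp_all add: chart_at assms mdiff_points[OF assms(4)] mdiff_points[OF assms(5)])

lemma linear_differential:
  assumes "charted M" "charted N" "mdiff M N F p"
  shows "linear (differential M N F p)"
  unfolding differential_eq_chart_deriv
  by (rule linear_chart_deriv[OF assms(3)]) (simp_all add: chart_at assms mdiff_points[OF assms(3)])

lemma smooth_map_mdiff: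
  assumes M: "charted M" and F: "smooth_map M N F" and p: "p \<in> points M"
  shows "mdiff M N F p"
  unfolding mdiff_def
proof (intro conjI allI impI ballI)
  have cont: "continuous_map (mtop M) (mtop N) F" using F unfolding smooth_map_def by blast
  show "p \<in> points M" "F p \<in> points N" using p cont continuous_map_image_subset_topspace by fastforce+
  fix W assume W: "openin (mtop N) W \<and> F p \<in> W"
  then have "openin (mtop M) {x \<in> points M. F x \<in> W}"
    using openin_continuous_map_preimage[OF cont] by blast
  then show "\<exists>V. openin (mtop M) V \<and> p \<in> V \<and> F ` V \<subseteq> W"
    using p W by (intro exI[of _ "{x \<in> points M. F x \<in> W}"]) auto
next
  fix a d assume "a \<in> atlas M" "d \<in> atlas N" and pd: "p \<in> fst a \<and> F p \<in> fst d"
  then have "Ck_on (Suc 0) (snd a ` (fst a \<inter> F -` fst d)) (snd d \<circ> F \<circ> chart_inv a)"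
    using F unfolding smooth_map_def smooth_on_def by blast
  then show "(snd d \<circ> F \<circ> chart_inv a) differentiable (at (snd a p))"
    by (rule Ck_on_differentiable) (use pd in auto)
qed

text \<open>In charts the identity is a transition map, so this is compatibility of the atlas, which
  \<open>charted\<close> omits.\<close>

lemma mdiff_id:
  assumes M: "smooth_manifold M" and p: "p \<in> points M"
  shows "mdiff M M (\<lambda>x. x) p"
  unfolding mdiff_def
proof (intro conjI allI impI ballI)
  show "p \<in> points M" "p \<in> points M" by fact+
  show "\<exists>V. openin (mtop M) V \<and> p \<in> V \<and> (\<lambda>x. x) ` V \<subseteq> W" if "openin (mtop M) W \<and> p \<in> W" for W
    using that by auto
  fix a d assume "a \<in> atlas M" "d \<in> atlas M" and pd: "p \<in> fst a \<and> p \<in> fst d"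
  then have "Ck_on (Suc 0) (snd a ` (fst a \<inter> fst d)) (snd d \<circ> chart_inv a)"
    using M unfolding smooth_manifold_def smooth_on_def by blast
  then have "(snd d \<circ> chart_inv a) differentiable (at (snd a p))"
    by (rule Ck_on_differentiable) (use pd in auto)
  then show "(snd d \<circ> (\<lambda>x. x) \<circ> chart_inv a) differentiable (at (snd a p))"
    by (simp add: comp_def)
qed

lemma chart_deriv_id:
  assumes "charted M" "a \<in> atlas M" "p \<in> fst a"
  shows "chart_deriv a a (\<lambda>x. x) p v = v"
proof -
  have "((snd a \<circ> (\<lambda>x. x) \<circ> chart_inv a) has_derivative (\<lambda>v. v)) (at (snd a p))"
    by (rule has_derivative_transform_within_open[OF has_derivative_ident charted_chart(2)[OF assms(1,2)]])
       (use assms(3) in \<open>auto simp: chart_inv_left[OF assms(1,2)]\<close>)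
  from frechet_derivative_at[OF this] show ?thesis unfolding chart_deriv_def by metis
qed

lemma mdiff_const: "p \<in> points M \<Longrightarrow> q \<in> points N \<Longrightarrow> mdiff M N (\<lambda>x. q) p"
  unfolding mdiff_def by (auto simp: comp_def)

lemma chart_deriv_const: "chart_deriv a c (\<lambda>x. q) p v = 0"
  unfolding chart_deriv_def by (simp add: comp_def)

lemma differential_ident:
  "charted A \<Longrightarrow> x \<in> points A \<Longrightarrow> differential A A (\<lambda>x. x) x u = u"
  unfolding differential_eq_chart_deriv by (rule chart_deriv_id[OF _ chart_at])

lemma differential_const: "differential A B (\<lambda>x. y) x u = 0"
  unfolding differential_eq_chart_deriv by (rule chart_deriv_const)

section \<open>Product manifolds, pairings and projections\<close>

lemma points_prod [simp]: "points (prod_manifold M N) = points M \<times> points N"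
  by (simp add: prod_manifold_def)

lemma atlas_prod: "c \<in> atlas (prod_manifold M N) \<longleftrightarrow>
    (\<exists>a\<in>atlas M. \<exists>b\<in>atlas N. c = (fst a \<times> fst b, map_prod (snd a) (snd b)))"
  unfolding prod_manifold_def manifold.select_convs mem_Collect_eq by blast

lemma charted_prod:
  assumes M: "charted M" and N: "charted N"
  shows "charted (prod_manifold M N)"
  unfolding charted_def
proof (intro conjI ballI)
  show "(\<Union>c\<in>atlas (prod_manifold M N). fst c) = points (prod_manifold M N)"
  proof (intro equalityI subsetI)
    fix x assume "x \<in> (\<Union>c\<in>atlas (prod_manifold M N). fst c)"
    then obtain a b where "a \<in> atlas M" "b \<in> atlas N" "x \<in> fst a \<times> fst b" by (auto simp: atlas_prod)
    then show "x \<in> points (prod_manifold M N)"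
      using charted_chart(3)[OF M] charted_chart(3)[OF N] unfolding points_prod by blast
  next
    fix x assume "x \<in> points (prod_manifold M N)"
    then have x: "fst x \<in> points M" "snd x \<in> points N" by auto
    obtain a where "a \<in> atlas M" "fst x \<in> fst a" using chart_at[OF M x(1)] by blast
    moreover obtain b where "b \<in> atlas N" "snd x \<in> fst b" using chart_at[OF N x(2)] by blast
    ultimately have "(fst a \<times> fst b, map_prod (snd a) (snd b)) \<in> atlas (prod_manifold M N)"
      "x \<in> fst (fst a \<times> fst b, map_prod (snd a) (snd b))"
      unfolding atlas_prod by (auto simp: mem_Times_iff)
    then show "x \<in> (\<Union>c\<in>atlas (prod_manifold M N). fst c)" by blast
  qed
next
  fix c assume "c \<in> atlas (prod_manifold M N)"
  then obtain a b where a: "a \<in> atlas M" and b: "b \<in> atlas N"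
    and c: "c = (fst a \<times> fst b, map_prod (snd a) (snd b))"
    unfolding atlas_prod by blast
  have im: "snd c ` fst c = (snd a ` fst a) \<times> (snd b ` fst b)"
    by (auto simp: c image_iff)
  show "openin (mtop (prod_manifold M N)) (fst c)"
    using charted_chart(1)[OF M a] charted_chart(1)[OF N b]
    by (simp add: c prod_manifold_def openin_prod_Times_iff)
  show "open (snd c ` fst c)"
    unfolding im by (intro open_Times charted_chart(2)[OF M a] charted_chart(2)[OF N b])
  obtain g h where "homeomorphic_maps (subtopology (mtop M) (fst a)) (top_of_set (snd a ` fst a)) (snd a) g"
    "homeomorphic_maps (subtopology (mtop N) (fst b)) (top_of_set (snd b ` fst b)) (snd b) h"
    using charted_chart(4)[OF M a] charted_chart(4)[OF N b] unfolding homeomorphic_map_maps by blast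
  then have "homeomorphic_maps
      (prod_topology (subtopology (mtop M) (fst a)) (subtopology (mtop N) (fst b)))
      (prod_topology (top_of_set (snd a ` fst a)) (top_of_set (snd b ` fst b)))
      (\<lambda>(x, y). (snd a x, snd b y)) (\<lambda>(x, y). (g x, h y))"
    unfolding homeomorphic_maps_prod by blast
  then have "homeomorphic_maps (subtopology (mtop (prod_manifold M N)) (fst c)) (top_of_set (snd c ` fst c))
      (snd c) (\<lambda>(x, y). (g x, h y))"
    unfolding im by (simp add: subtopology_Times c prod_manifold_def map_prod_def euclidean_product_topology
        )
  then show "homeomorphic_map (subtopology (mtop (prod_manifold M N)) (fst c)) (top_of_set (snd c ` fst c)) (snd c)"
    unfolding homeomorphic_map_maps by blast
qed

lemma chart_inv_prod:
  assumes M: "charted M" and N: "charted N" and a: "a \<in> atlas M" and b: "b \<in> atlas N"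
    and x: "x \<in> snd a ` fst a" and y: "y \<in> snd b ` fst b"
  shows "chart_inv (fst a \<times> fst b, map_prod (snd a) (snd b)) (x, y) = (chart_inv a x, chart_inv b y)"
proof -
  let ?c = "(fst a \<times> fst b, map_prod (snd a) (snd b))"
  have c: "?c \<in> atlas (prod_manifold M N)" using a b unfolding atlas_prod by blast
  have "chart_inv ?c (snd ?c (chart_inv a x, chart_inv b y)) = (chart_inv a x, chart_inv b y)"
    by (rule chart_inv_left[OF charted_prod[OF M N] c]) (use chart_inv_in[OF x] chart_inv_in[OF y] in simp)
  then show ?thesis by (simp add: chart_inv_right[OF x] chart_inv_right[OF y])
qed

lemma chart_deriv_Pair:
  assumes F: "mdiff M N F p" and G: "mdiff M P G p"
    and a: "a \<in> atlas M" "p \<in> fst a" and c: "c \<in> atlas N" "F p \<in> fst c" and d: "d \<in> atlas P" "G p \<in> fst d"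
  shows "((snd (fst c \<times> fst d, map_prod (snd c) (snd d)) \<circ> (\<lambda>x. (F x, G x)) \<circ> chart_inv a) has_derivative
      (\<lambda>v. (chart_deriv a c F p v, chart_deriv a d G p v))) (at (snd a p))"
    and "chart_deriv a (fst c \<times> fst d, map_prod (snd c) (snd d)) (\<lambda>x. (F x, G x)) p v =
      (chart_deriv a c F p v, chart_deriv a d G p v)"
proof -
  show *: "((snd (fst c \<times> fst d, map_prod (snd c) (snd d)) \<circ> (\<lambda>x. (F x, G x)) \<circ> chart_inv a) has_derivative
      (\<lambda>v. (chart_deriv a c F p v, chart_deriv a d G p v))) (at (snd a p))"
    using has_derivative_Pair[OF mdiff_has_derivative[OF F a(1) c(1) a(2) c(2)]
        mdiff_has_derivative[OF G a(1) d(1) a(2) d(2)]]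
    by (simp add: comp_def)
  show "chart_deriv a (fst c \<times> fst d, map_prod (snd c) (snd d)) (\<lambda>x. (F x, G x)) p v =
      (chart_deriv a c F p v, chart_deriv a d G p v)"
    using frechet_derivative_at[OF *] unfolding chart_deriv_def by metis
qed

lemma mdiff_Pair:
  assumes F: "mdiff M N F p" and G: "mdiff M P G p"
  shows "mdiff M (prod_manifold N P) (\<lambda>x. (F x, G x)) p"
  unfolding mdiff_def
proof (intro conjI allI impI ballI)
  show "p \<in> points M" "(F p, G p) \<in> points (prod_manifold N P)"
    using mdiff_points[OF F] mdiff_points[OF G] by auto
  fix W assume "openin (mtop (prod_manifold N P)) W \<and> (F p, G p) \<in> W"
  then obtain U V where UV: "openin (mtop N) U" "openin (mtop P) V" "F p \<in> U" "G p \<in> V" "U \<times> V \<subseteq> W"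
    unfolding prod_manifold_def manifold.select_convs openin_prod_topology_alt by meson
  obtain A where A: "openin (mtop M) A" "p \<in> A" "F ` A \<subseteq> U" using mdiff_cont[OF F UV(1,3)] .
  obtain B where B: "openin (mtop M) B" "p \<in> B" "G ` B \<subseteq> V" using mdiff_cont[OF G UV(2,4)] .
  show "\<exists>V. openin (mtop M) V \<and> p \<in> V \<and> (\<lambda>x. (F x, G x)) ` V \<subseteq> W"
    using A B UV(5) by (intro exI[of _ "A \<inter> B"]) auto
next
  fix a c assume "a \<in> atlas M" "c \<in> atlas (prod_manifold N P)" "p \<in> fst a \<and> (F p, G p) \<in> fst c"
  then show "(snd c \<circ> (\<lambda>x. (F x, G x)) \<circ> chart_inv a) differentiable (at (snd a p))"
    using chart_deriv_Pair(1)[OF F G, of a] unfolding atlas_prod differentiable_def by fastforce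
qed

text \<open>In a product chart the projection is the linear projection followed by a transition map
  of \<open>M\<close>.\<close>

lemma mdiff_fst:
  assumes M: "smooth_manifold M" and N: "charted N" and p: "p \<in> points (prod_manifold M N)"
  shows "mdiff (prod_manifold M N) M fst p"
  unfolding mdiff_def
proof (intro conjI allI impI ballI)
  show "p \<in> points (prod_manifold M N)" "fst p \<in> points M" using p by auto
  fix W assume W: "openin (mtop M) W \<and> fst p \<in> W"
  show "\<exists>V. openin (mtop (prod_manifold M N)) V \<and> p \<in> V \<and> fst ` V \<subseteq> W"
    using W p by (intro exI[of _ "W \<times> points N"]) (auto simp: prod_manifold_def openin_prod_Times_iff)
next
  fix a d assume "a \<in> atlas (prod_manifold M N)" and d: "d \<in> atlas M" and pd: "p \<in> fst a \<and> fst p \<in> fst d"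
  then obtain b c where b: "b \<in> atlas M" and c: "c \<in> atlas N"
    and a: "a = (fst b \<times> fst c, map_prod (snd b) (snd c))" unfolding atlas_prod by blast
  note M' = smooth_manifold_charted[OF M]
  have pb: "fst p \<in> fst b" "snd p \<in> fst c" using pd a by auto
  have 1: "((snd d \<circ> (\<lambda>x. x) \<circ> chart_inv b) has_derivative chart_deriv b d (\<lambda>x. x) (fst p)) (at (fst (snd a p)))"
    using mdiff_has_derivative[OF mdiff_id[OF M] b d, of "fst p"] pb pd p a by auto
  have "((snd d \<circ> fst \<circ> chart_inv a) has_derivative (\<lambda>v. chart_deriv b d (\<lambda>x. x) (fst p) (fst v))) (at (snd a p))"
  proof (rule has_derivative_transform_within_open[OF has_derivative_compose[OF has_derivative_fst[OF has_derivative_ident] 1]])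
    show "open ((snd b ` fst b) \<times> (snd c ` fst c))"
      by (intro open_Times charted_chart(2)[OF M' b] charted_chart(2)[OF N c])
    show "snd a p \<in> (snd b ` fst b) \<times> (snd c ` fst c)"
      using pb by (cases p) (auto simp: a)
    show "(snd d \<circ> (\<lambda>x. x) \<circ> chart_inv b) (fst y) = (snd d \<circ> fst \<circ> chart_inv a) y"
      if "y \<in> (snd b ` fst b) \<times> (snd c ` fst c)" for y
      using that chart_inv_prod[OF M' N b c, of "fst y" "snd y"] by (cases y) (auto simp: a)
  qed
  then show "(snd d \<circ> fst \<circ> chart_inv a) differentiable (at (snd a p))"
    unfolding differentiable_def by blast
qed

text \<open>Differentiability of the identity of \<open>N\<close> is assumed in place of
  \<open>smooth_manifold N\<close> because \<open>N\<close> will itself be a product, for which only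
  \<open>charted\<close> has been established.\<close>

lemma mdiff_snd:
  assumes M: "charted M" and N: "\<And>q. q \<in> points N \<Longrightarrow> mdiff N N (\<lambda>x. x) q" and N': "charted N"
    and p: "p \<in> points (prod_manifold M N)"
  shows "mdiff (prod_manifold M N) N snd p"
  unfolding mdiff_def
proof (intro conjI allI impI ballI)
  show "p \<in> points (prod_manifold M N)" "snd p \<in> points N" using p by auto
  fix W assume W: "openin (mtop N) W \<and> snd p \<in> W"
  show "\<exists>V. openin (mtop (prod_manifold M N)) V \<and> p \<in> V \<and> snd ` V \<subseteq> W"
    using W p by (intro exI[of _ "points M \<times> W"]) (auto simp: prod_manifold_def openin_prod_Times_iff)
next
  fix a d assume "a \<in> atlas (prod_manifold M N)" and d: "d \<in> atlas N" and pd: "p \<in> fst a \<and> snd p \<in> fst d"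
  then obtain b c where b: "b \<in> atlas M" and c: "c \<in> atlas N"
    and a: "a = (fst b \<times> fst c, map_prod (snd b) (snd c))" unfolding atlas_prod by blast
  have pb: "fst p \<in> fst b" "snd p \<in> fst c" using pd a by auto
  have 1: "((snd d \<circ> (\<lambda>x. x) \<circ> chart_inv c) has_derivative chart_deriv c d (\<lambda>x. x) (snd p)) (at (snd (snd a p)))"
    using mdiff_has_derivative[OF N c d, of "snd p"] pb pd p a by auto
  have "((snd d \<circ> snd \<circ> chart_inv a) has_derivative (\<lambda>v. chart_deriv c d (\<lambda>x. x) (snd p) (snd v))) (at (snd a p))"
  proof (rule has_derivative_transform_within_open[OF has_derivative_compose[OF has_derivative_snd[OF has_derivative_ident] 1]])
    show "open ((snd b ` fst b) \<times> (snd c ` fst c))"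
      by (intro open_Times charted_chart(2)[OF M b] charted_chart(2)[OF N' c])
    show "snd a p \<in> (snd b ` fst b) \<times> (snd c ` fst c)"
      using pb by (cases p) (auto simp: a)
    show "(snd d \<circ> (\<lambda>x. x) \<circ> chart_inv c) (snd y) = (snd d \<circ> snd \<circ> chart_inv a) y"
      if "y \<in> (snd b ` fst b) \<times> (snd c ` fst c)" for y
      using that chart_inv_prod[OF M N' b c, of "fst y" "snd y"] by (cases y) (auto simp: a)
  qed
  then show "(snd d \<circ> snd \<circ> chart_inv a) differentiable (at (snd a p))"
    unfolding differentiable_def by blast
qed


section \<open>Closedness of the Kaehler form\<close>

text \<open>The field with constant components \<open>u\<close> in the chart \<open>C\<close>. The
  change of chart is forced by the encoding: a vector at \<open>m\<close> is stored in the
  components of \<open>chart_at M m\<close>.\<close>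

definition coord_field :: "('a, 'e::euclidean_space) manifold \<Rightarrow> ('a, 'e) chart \<Rightarrow> 'e \<Rightarrow> 'a \<Rightarrow> 'e" where
  "coord_field M C u m = chart_deriv C (chart_at M m) (\<lambda>x. x) m u"

lemma tcoord_coord_field:
  assumes M: "smooth_manifold M" and C: "C \<in> atlas M" "m \<in> fst C" and c: "c \<in> atlas M" "m \<in> fst c"
  shows "tcoord M c m (coord_field M C u m) = chart_deriv C c (\<lambda>x. x) m u"
proof -
  note M' = smooth_manifold_charted[OF M]
  have m: "m \<in> points M" using charted_chart(3)[OF M' C(1)] C(2) by blast
  show ?thesis
    unfolding tcoord_eq_chart_deriv coord_field_def
    using chart_deriv_compose(2)[OF M' M' mdiff_id[OF M m] mdiff_id[OF M m] C chart_at[OF M' m] c]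
    by simp
qed

lemma coord_field_chart_at:
  assumes "charted M" "m \<in> points M"
  shows "coord_field M (chart_at M m) u m = u"
  unfolding coord_field_def by (rule chart_deriv_id[OF assms(1) chart_at[OF assms]])

lemma linear_coord_field:
  assumes M: "smooth_manifold M" and C: "C \<in> atlas M" "m \<in> fst C"
  shows "linear (\<lambda>u. coord_field M C u m)"
proof -
  note M' = smooth_manifold_charted[OF M]
  have m: "m \<in> points M" using charted_chart(3)[OF M' C(1)] C(2) by blast
  show ?thesis
    unfolding coord_field_def
    by (rule linear_chart_deriv[OF mdiff_id[OF M m] C(1) chart_at(1)[OF M' m] C(2) chart_at(2)[OF M' m]])
qed

text \<open>In another chart \<open>c\<close> the components are the derivative, in the fixed
  direction \<open>u\<close>, of the transition map from \<open>C\<close> to \<open>c\<close>,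
  evaluated along the opposite transition map; the one order lost is harmless.\<close>

lemma smooth_coord_field:
  assumes M: "smooth_manifold M" and C: "C \<in> atlas M"
  shows "smooth_vfield M (fst C) (coord_field M C u)"
  unfolding smooth_vfield_def smooth_on_def
proof (intro ballI allI)
  fix c k assume c: "c \<in> atlas M"
  note M' = smooth_manifold_charted[OF M]
  let ?S = "snd c ` (fst c \<inter> fst C)" and ?T = "snd C ` (fst C \<inter> fst c)"
  have S: "open ?S" by (rule open_chart_image[OF M' c charted_chart(1)[OF M' C]])
  have T: "open ?T" by (rule open_chart_image[OF M' C charted_chart(1)[OF M' c]])
  have trans: "Ck_on n (snd a ` (fst a \<inter> fst b)) (snd b \<circ> chart_inv a)"
    if "a \<in> atlas M" "b \<in> atlas M" for a b n
    using M that unfolding smooth_manifold_def smooth_on_def by blast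
  have "Ck_on k ?T (\<lambda>y. frechet_derivative (snd c \<circ> chart_inv C) (at y) u)"
    using trans[OF C c, of "Suc k"] by simp
  from Ck_on_compose[OF S T _ trans[OF c C, of k] this]
  have "Ck_on k ?S (\<lambda>x. frechet_derivative (snd c \<circ> chart_inv C) (at ((snd C \<circ> chart_inv c) x)) u)"
    using chart_inv_left[OF M' c] by fastforce
  then show "Ck_on k ?S (\<lambda>x. tcoord M c (chart_inv c x) (coord_field M C u (chart_inv c x)))"
  proof (rule Ck_on_cong[OF S, rotated])
    fix x assume "x \<in> ?S"
    note x = chart_inv_image_in[OF M' c this]
    show "frechet_derivative (snd c \<circ> chart_inv C) (at ((snd C \<circ> chart_inv c) x)) u =
        tcoord M c (chart_inv c x) (coord_field M C u (chart_inv c x))"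
      unfolding tcoord_coord_field[OF M C x(2) c x(1)] by (simp add: chart_deriv_def comp_def)
  qed
qed

text \<open>\<open>lie_bracket\<close> is computed in \<open>chart_at M m\<close>, where both fields
  have constant components, so both derivatives vanish.\<close>

lemma lie_bracket_coord_field:
  assumes M: "smooth_manifold M" and m: "m \<in> points M"
  shows "lie_bracket M (coord_field M (chart_at M m) u) (coord_field M (chart_at M m) v) m = 0"
proof -
  note M' = smooth_manifold_charted[OF M]
  define C where "C = chart_at M m"
  have C: "C \<in> atlas M" "m \<in> fst C" unfolding C_def by (rule chart_at[OF M' m])+
  have "((\<lambda>x. tcoord M C (chart_inv C x) (coord_field M C w (chart_inv C x))) has_derivative (\<lambda>h. 0)) (at (snd C m))" for w
  proof (rule has_derivative_transform_within_open[OF has_derivative_const charted_chart(2)[OF M' C(1)]])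
    show "snd C m \<in> snd C ` fst C" using C(2) by blast
    fix y assume "y \<in> snd C ` fst C"
    note y = chart_inv_in[OF this]
    show "w = tcoord M C (chart_inv C y) (coord_field M C w (chart_inv C y))"
      using tcoord_coord_field[OF M C(1) y C(1) y] chart_deriv_id[OF M' C(1) y] by metis
  qed
  from frechet_derivative_at[OF this] have
    "frechet_derivative (\<lambda>x. tcoord M C (chart_inv C x) (coord_field M C w (chart_inv C x))) (at (snd C m)) h = 0" for w h
    by metis
  then show ?thesis
    unfolding lie_bracket_def Let_def C_def[symmetric] by simp
qed

definition kaehler_form_in_chart ::
    "('a, 'e::euclidean_space) manifold \<Rightarrow> ('a \<Rightarrow> 'e \<Rightarrow> 'e) \<Rightarrow> ('a \<Rightarrow> 'e \<Rightarrow> 'e \<Rightarrow> real)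
     \<Rightarrow> ('a, 'e) chart \<Rightarrow> 'e \<Rightarrow> 'e \<Rightarrow> 'e \<Rightarrow> real" where
  "kaehler_form_in_chart M J g C y u v =
     (let m = chart_inv C y in g m (J m (coord_field M C u m)) (coord_field M C v m))"

lemma kaehlerD:
  assumes "kaehler_manifold M J g"
  shows "smooth_manifold M" "riemannian_metric M g"
    "\<And>p. p \<in> points M \<Longrightarrow> bilinear (g p)"
    "\<And>p u v. p \<in> points M \<Longrightarrow> g p u v = g p v u"
    "\<And>p v. p \<in> points M \<Longrightarrow> v \<noteq> 0 \<Longrightarrow> g p v v > 0"
    "\<And>p. p \<in> points M \<Longrightarrow> linear (J p)"
    "\<And>p v. p \<in> points M \<Longrightarrow> J p (J p v) = - v"
    "\<And>p u v. p \<in> points M \<Longrightarrow> g p (J p u) (J p v) = g p u v"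
    "\<And>W X. openin (mtop M) W \<Longrightarrow> smooth_vfield M W X \<Longrightarrow> smooth_vfield M W (\<lambda>p. J p (X p))"
  using assms
  unfolding kaehler_manifold_def riemannian_manifold_def riemannian_metric_def almost_complex_structure_def
  by simp_all

text \<open>Apply the isometry \<open>J\<close> to both arguments and use that its square is minus
  the identity.\<close>

lemma kaehler_form_antisym:
  assumes "kaehler_manifold M J g" "p \<in> points M"
  shows "g p (J p u) v = - g p (J p v) u"
proof -
  have "g p (J p u) v = g p (J p (J p u)) (J p v)"
    using kaehlerD(8)[OF assms] by metis
  also have "\<dots> = g p (- u) (J p v)" by (simp add: kaehlerD(7)[OF assms])
  also have "\<dots> = - g p u (J p v)" by (rule bilinear_lneg[OF kaehlerD(3)[OF assms]])
  finally show ?thesis using kaehlerD(4)[OF assms] by metis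
qed

lemma bilinear_kaehler_form_in_chart:
  assumes K: "kaehler_manifold M J g" and C: "C \<in> atlas M" and y: "y \<in> snd C ` fst C"
  shows "bilinear (kaehler_form_in_chart M J g C y)"
proof -
  note M = kaehlerD(1)[OF K] note M' = smooth_manifold_charted[OF M]
  have mC: "chart_inv C y \<in> fst C" by (rule chart_inv_in[OF y])
  then have m: "chart_inv C y \<in> points M" using charted_chart(3)[OF M' C] by blast
  have lin: "linear (\<lambda>u. coord_field M C u (chart_inv C y))" by (rule linear_coord_field[OF M C mC])
  have B: "bilinear (g (chart_inv C y))" by (rule kaehlerD(3)[OF K m])
  show ?thesis
    unfolding bilinear_def kaehler_form_in_chart_def Let_def
    using linear_compose[OF lin B[unfolded bilinear_def, THEN conjunct1, rule_format]]
      linear_compose[OF linear_compose[OF lin kaehlerD(6)[OF K m]] B[unfolded bilinear_def, THEN conjunct2, rule_format]]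
    by (simp add: comp_def)
qed

text \<open>Metric compatibility and parallelism of \<open>J\<close> express each derivative of a
  component by two terms \<open>om (G c a) b\<close> and \<open>om a (G c b)\<close>. In the cyclic
  sum the six terms cancel in pairs, by symmetry of \<open>G\<close> and antisymmetry of
  \<open>om\<close>.\<close>

lemma kaehler_form_in_chart_closed:
  assumes K: "kaehler_manifold M J g" and m: "m \<in> points M"
  defines "C \<equiv> chart_at M m"
  defines "D \<equiv> \<lambda>u v. frechet_derivative (\<lambda>y. kaehler_form_in_chart M J g C y u v) (at (snd C m))"
  shows "((\<lambda>y. kaehler_form_in_chart M J g C y u v) has_derivative D u v) (at (snd C m))"
    and "D u v w + D v w u + D w u v = 0"
proof -
  note M = kaehlerD(1)[OF K] note M' = smooth_manifold_charted[OF M]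
  have C: "C \<in> atlas M" "m \<in> fst C" unfolding C_def by (rule chart_at[OF M' m])+
  let ?W = "fst C" and ?E = "coord_field M C"
  have W: "openin (mtop M) ?W" by (rule charted_chart(1)[OF M' C(1)])
  have E: "smooth_vfield M ?W (?E a)" for a by (rule smooth_coord_field[OF M C(1)])
  have JE: "smooth_vfield M ?W (\<lambda>q. J q (?E a q))" for a by (rule kaehlerD(9)[OF K W E])
  have Em: "?E a m = a" for a unfolding C_def by (rule coord_field_chart_at[OF M' m])
  show "((\<lambda>y. kaehler_form_in_chart M J g C y u v) has_derivative D u v) (at (snd C m))" for u v
  proof -
    have "smooth_fun M ?W (\<lambda>p. g p (J p (?E u p)) (?E v p))"
      using kaehlerD(2)[OF K, unfolded riemannian_metric_def, THEN conjunct2, rule_format, OF conjI[OF W conjI[OF JE E]]] .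
    then have "Ck_on (Suc 0) (snd C ` (fst C \<inter> ?W)) ((\<lambda>p. g p (J p (?E u p)) (?E v p)) \<circ> chart_inv C)"
      using C(1) unfolding smooth_fun_def smooth_on_def by blast
    from Ck_on_has_derivative[OF this, of "snd C m"] C(2) show ?thesis
      by (simp add: D_def kaehler_form_in_chart_def Let_def comp_def)
  qed
  obtain nab where LC: "levi_civita_connection M g nab" and
    par: "\<forall>W Y v. \<forall>p\<in>W. openin (mtop M) W \<and> smooth_vfield M W Y \<longrightarrow>
      nab p v (\<lambda>q. J q (Y q)) = J p (nab p v Y)"
    using K unfolding kaehler_manifold_def by (elim conjE exE)
  note LC' = LC[unfolded levi_civita_connection_def]
  have nJ: "nab m v (\<lambda>q. J q (Y q)) = J m (nab m v Y)" if "smooth_vfield M ?W Y" for Y v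
    by (rule par[rule_format, OF C(2) conjI[OF W that]])
  have tors: "nab m (X m) Y - nab m (Y m) X = lie_bracket M X Y m"
    if "smooth_vfield M ?W X" "smooth_vfield M ?W Y" for X Y
    by (rule LC'[THEN conjunct2, THEN conjunct1, rule_format, OF C(2) conjI[OF W conjI[OF that]]])
  have metr: "dir_deriv M (\<lambda>q. g q (Y q) (Z q)) m w = g m (nab m w Y) (Z m) + g m (Y m) (nab m w Z)"
    if "smooth_vfield M ?W Y" "smooth_vfield M ?W Z" for Y Z w
    by (rule LC'[THEN conjunct2, THEN conjunct2, rule_format, OF C(2) conjI[OF W conjI[OF that]]])
  \<comment> \<open>The Christoffel symbols at \<open>m\<close>; they are symmetric because the
    connection is torsion-free and coordinate fields commute.\<close>
  define G where "G a b = nab m a (?E b)" for a b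
  have sym: "G a b = G b a" for a b
    using tors[OF E E, of a b] lie_bracket_coord_field[OF M m, of a b] Em unfolding G_def C_def by simp
  define om where "om a b = g m (J m a) b" for a b
  have D: "D a b c = om (G c a) b + om a (G c b)" for a b c
  proof -
    have "D a b c = dir_deriv M (\<lambda>q. g q (J q (?E a q)) (?E b q)) m c"
      unfolding D_def dir_deriv_def kaehler_form_in_chart_def Let_def coord_at_def C_def by (simp add: comp_def)
    then show ?thesis
      using metr[OF JE E, of a b c] nJ[OF E, of c a] by (simp add: om_def G_def Em)
  qed
  have anti: "om a b = - om b a" for a b
    unfolding om_def by (rule kaehler_form_antisym[OF K m])
  show "D u v w + D v w u + D w u v = 0"
    unfolding D using sym anti by (smt (verit))
qed


section \<open>Pullback of the Kaehler form\<close>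

lemma bilinear_basis_expansion:
  fixes b :: "'a::euclidean_space \<Rightarrow> 'b::euclidean_space \<Rightarrow> real"
  assumes "bilinear b"
  shows "b u v = (\<Sum>i\<in>Basis. \<Sum>j\<in>Basis. (u \<bullet> i) * ((v \<bullet> j) * b i j))"
proof -
  have "b u v = b (\<Sum>i\<in>Basis. (u \<bullet> i) *\<^sub>R i) (\<Sum>j\<in>Basis. (v \<bullet> j) *\<^sub>R j)"
    by (simp add: euclidean_representation)
  also have "\<dots> = (\<Sum>(i, j)\<in>Basis \<times> Basis. b ((u \<bullet> i) *\<^sub>R i) ((v \<bullet> j) *\<^sub>R j))"
    by (rule bilinear_sum[OF assms])
  finally show ?thesis
    by (simp add: sum.cartesian_product bilinear_lmul[OF assms] bilinear_rmul[OF assms] mult.left_commute)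
qed

text \<open>Product rule for three moving slots: base point and both arguments. Expanding in the
  basis reduces it to products of real functions, so differentiability of \<open>B\<close> is needed
  only for fixed arguments.\<close>

lemma has_derivative_bilinear_family:
  fixes B :: "'k::euclidean_space \<Rightarrow> 'k \<Rightarrow> 'k \<Rightarrow> real" and G P Q :: "'x::real_normed_vector \<Rightarrow> 'k"
  assumes U: "open U" "x0 \<in> U" and V: "open V" "G ` U \<subseteq> V"
    and bil: "\<And>y. y \<in> V \<Longrightarrow> bilinear (B y)"
    and dB: "\<And>u v. ((\<lambda>y. B y u v) has_derivative D u v) (at (G x0))"
    and G: "(G has_derivative G') (at x0)" and P: "(P has_derivative P') (at x0)" and Q: "(Q has_derivative Q') (at x0)"
  shows "((\<lambda>x. B (G x) (P x) (Q x)) has_derivative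
      (\<lambda>h. D (P x0) (Q x0) (G' h) + B (G x0) (P' h) (Q x0) + B (G x0) (P x0) (Q' h))) (at x0)"
proof -
  have G0: "G x0 \<in> V" using U V by blast
  \<comment> \<open>The hypothesis \<open>dB\<close> treats each pair \<open>u\<close>,
    \<open>v\<close> separately; bilinearity of \<open>D\<close> in them is recovered from
    uniqueness of derivatives.\<close>
  have D: "D u v w = (\<Sum>i\<in>Basis. \<Sum>j\<in>Basis. (u \<bullet> i) * ((v \<bullet> j) * D i j w))" for u v w
  proof -
    have "((\<lambda>y. \<Sum>i\<in>Basis. \<Sum>j\<in>Basis. (u \<bullet> i) * ((v \<bullet> j) * B y i j)) has_derivative
        (\<lambda>w. \<Sum>i\<in>Basis. \<Sum>j\<in>Basis. (u \<bullet> i) * ((v \<bullet> j) * D i j w))) (at (G x0))"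
      by (intro has_derivative_sum has_derivative_mult_right dB)
    then have "((\<lambda>y. B y u v) has_derivative
        (\<lambda>w. \<Sum>i\<in>Basis. \<Sum>j\<in>Basis. (u \<bullet> i) * ((v \<bullet> j) * D i j w))) (at (G x0))"
      by (rule has_derivative_transform_within_open[OF _ V(1) G0])
         (rule bilinear_basis_expansion[OF bil, symmetric])
    from has_derivative_unique[OF dB this] show ?thesis by metis
  qed
  have BG: "((\<lambda>x. B (G x) i j) has_derivative (\<lambda>h. D i j (G' h))) (at x0)" for i j
    by (rule has_derivative_compose[OF G dB])
  have "((\<lambda>x. \<Sum>i\<in>Basis. \<Sum>j\<in>Basis. (P x \<bullet> i) * ((Q x \<bullet> j) * B (G x) i j)) has_derivative
      (\<lambda>h. \<Sum>i\<in>Basis. \<Sum>j\<in>Basis. (P x0 \<bullet> i) * ((Q x0 \<bullet> j) * D i j (G' h) + (Q' h \<bullet> j) * B (G x0) i j)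
        + (P' h \<bullet> i) * ((Q x0 \<bullet> j) * B (G x0) i j))) (at x0)"
    by (intro has_derivative_sum has_derivative_mult has_derivative_inner_left P Q BG)
  moreover have "(\<Sum>i\<in>Basis. \<Sum>j\<in>Basis. (P x \<bullet> i) * ((Q x \<bullet> j) * B (G x) i j)) = B (G x) (P x) (Q x)"
    if "x \<in> U" for x
    by (rule bilinear_basis_expansion[OF bil, symmetric]) (use that V(2) in blast)
  moreover have "(\<Sum>i\<in>Basis. \<Sum>j\<in>Basis. (P x0 \<bullet> i) * ((Q x0 \<bullet> j) * D i j (G' h) + (Q' h \<bullet> j) * B (G x0) i j)
        + (P' h \<bullet> i) * ((Q x0 \<bullet> j) * B (G x0) i j)) =
      D (P x0) (Q x0) (G' h) + B (G x0) (P' h) (Q x0) + B (G x0) (P x0) (Q' h)" for h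
    unfolding D[of "P x0"] bilinear_basis_expansion[OF bil[OF G0], of "P' h"]
      bilinear_basis_expansion[OF bil[OF G0], of "P x0"] sum.distrib[symmetric]
    by (intro sum.cong refl) (simp add: algebra_simps)
  ultimately show ?thesis
    by (auto intro: has_derivative_transform_within_open[OF _ U])
qed

text \<open>The exterior derivative commutes with pullback. Besides the cyclic sum for
  \<open>B\<close>, the product rule yields six terms with second derivatives of \<open>G\<close>;
  they cancel in pairs because those are symmetric and \<open>B (G x0)\<close> is
  antisymmetric.\<close>

lemma pullback_closed_euclidean:
  fixes B :: "'k::euclidean_space \<Rightarrow> 'k \<Rightarrow> 'k \<Rightarrow> real" and G :: "'x::euclidean_space \<Rightarrow> 'k"
  assumes U: "open U" "x0 \<in> U" and V: "open V" "G ` U \<subseteq> V" and C2: "Ck_on 2 U G"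
    and bil: "\<And>y. y \<in> V \<Longrightarrow> bilinear (B y)"
    and dB: "\<And>u v. ((\<lambda>y. B y u v) has_derivative D u v) (at (G x0))"
    and anti: "\<And>u v. B (G x0) u v = - B (G x0) v u"
    and closed: "\<And>u v w. D u v w + D v w u + D w u v = 0"
  shows "\<exists>H. (\<forall>u v. ((\<lambda>x. B (G x) (frechet_derivative G (at x) u) (frechet_derivative G (at x) v))
      has_derivative H u v) (at x0)) \<and> (\<forall>u v w. H u v w + H v w u + H w u v = 0)"
proof -
  have C2': "Ck_on (Suc (Suc 0)) U G" using C2 by (simp only: numeral_2_eq_2)
  define DG where "DG x = frechet_derivative G (at x)" for x
  define S where "S u = frechet_derivative (\<lambda>x. DG x u) (at x0)" for u
  have G: "(G has_derivative DG x0) (at x0)"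
    unfolding DG_def by (rule Ck_on_has_derivative[OF C2' U(2)])
  have S: "((\<lambda>x. DG x u) has_derivative S u) (at x0)" for u
  proof -
    have "Ck_on (Suc 0) U (\<lambda>x. DG x u)" using C2' unfolding DG_def by simp
    then show ?thesis unfolding S_def by (rule Ck_on_has_derivative[OF _ U(2)])
  qed
  have sym: "S u v = S v u" for u v
    unfolding S_def DG_def by (rule second_derivative_symmetric[OF U C2])
  define H where "H u v w = D (DG x0 u) (DG x0 v) (DG x0 w) + B (G x0) (S u w) (DG x0 v) + B (G x0) (DG x0 u) (S v w)"
    for u v w
  have "((\<lambda>x. B (G x) (DG x u) (DG x v)) has_derivative H u v) (at x0)" for u v
    unfolding H_def by (rule has_derivative_bilinear_family[OF U V bil dB G S S])
  moreover have "H u v w + H v w u + H w u v = 0" for u v w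
    unfolding H_def
    using closed[of "DG x0 u" "DG x0 v" "DG x0 w"]
      anti[of "DG x0 u" "S v w"] anti[of "DG x0 v" "S w u"] anti[of "DG x0 w" "S u v"]
      sym[of u v] sym[of v w] sym[of w u]
    by simp
  ultimately show ?thesis unfolding DG_def by blast
qed

lemma pullback_closed:
  fixes F :: "'b \<Rightarrow> 'a"
  assumes K: "kaehler_manifold M J g" and N: "charted N" and F: "smooth_map N M F"
    and P: "P \<in> atlas N" and x: "x \<in> fst P"
  defines "T \<equiv> \<lambda>q. chart_deriv P (chart_at M (F q)) F q"
  defines "h \<equiv> \<lambda>u v q. g (F q) (J (F q) (T q u)) (T q v)"
  shows "\<exists>H. (\<forall>u v. ((\<lambda>y. h u v (chart_inv P y)) has_derivative H u v) (at (snd P x))) \<and>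
    (\<forall>u v w. H u v w + H v w u + H w u v = 0)"
proof -
  note M = kaehlerD(1)[OF K] note M' = smooth_manifold_charted[OF M]
  have mF: "mdiff N M F q" if "q \<in> points N" for q by (rule smooth_map_mdiff[OF N F that])
  have xN: "x \<in> points N" using charted_chart(3)[OF N P] x by blast
  have m: "F x \<in> points M" by (rule mdiff_points(2)[OF mF[OF xN]])
  define C where "C = chart_at M (F x)"
  have C: "C \<in> atlas M" "F x \<in> fst C" unfolding C_def by (rule chart_at[OF M' m])+
  define U where "U = snd P ` (fst P \<inter> F -` fst C)"
  define G where "G = snd C \<circ> F \<circ> chart_inv P"
  define B where "B = kaehler_form_in_chart M J g C"
  define D where "D u v = frechet_derivative (\<lambda>y. B y u v) (at (snd C (F x)))" for u v
  have "continuous_map (mtop N) (mtop M) F" using F unfolding smooth_map_def by blast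
  then have "openin (mtop N) {q \<in> points N. F q \<in> fst C}"
    by (rule openin_continuous_map_preimage[OF _ charted_chart(1)[OF M' C(1)]])
  from open_chart_image[OF N P this]
  have U: "open U"
  proof -
    have "fst P \<inter> {q \<in> points N. F q \<in> fst C} = fst P \<inter> F -` fst C"
      using charted_chart(3)[OF N P] by blast
    with \<open>open (snd P ` (fst P \<inter> {q \<in> points N. F q \<in> fst C}))\<close> show ?thesis unfolding U_def by simp
  qed
  have xU: "snd P x \<in> U" using x C(2) unfolding U_def by blast
  have inU: "chart_inv P y \<in> fst P" "F (chart_inv P y) \<in> fst C" "snd P (chart_inv P y) = y" if "y \<in> U" for y
    using chart_inv_image_in[OF N P that[unfolded U_def]] by auto
  have V: "open (snd C ` fst C)" by (rule charted_chart(2)[OF M' C(1)])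
  have GV: "G ` U \<subseteq> snd C ` fst C" unfolding G_def using inU(2) by auto
  have C2: "Ck_on 2 U G"
    using F P C(1) unfolding smooth_map_def smooth_on_def U_def G_def by blast
  have bil: "bilinear (B y)" if "y \<in> snd C ` fst C" for y
    unfolding B_def by (rule bilinear_kaehler_form_in_chart[OF K C(1) that])
  have Gx: "G (snd P x) = snd C (F x)" by (simp add: G_def chart_inv_left[OF N P x])
  have dB: "((\<lambda>y. B y u v) has_derivative D u v) (at (G (snd P x)))" for u v
    unfolding Gx D_def B_def C_def by (rule kaehler_form_in_chart_closed(1)[OF K m])
  have closed: "D u v w + D v w u + D w u v = 0" for u v w
    unfolding D_def B_def C_def by (rule kaehler_form_in_chart_closed(2)[OF K m])
  have anti: "B (G (snd P x)) u v = - B (G (snd P x)) v u" for u v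
    unfolding B_def kaehler_form_in_chart_def Let_def Gx chart_inv_left[OF M' C] by (rule kaehler_form_antisym[OF K m])
  obtain H where H: "((\<lambda>y. B (G y) (frechet_derivative G (at y) u) (frechet_derivative G (at y) v))
      has_derivative H u v) (at (snd P x))" "H u v w + H v w u + H w u v = 0" for u v w
    using pullback_closed_euclidean[OF U xU V GV C2 bil dB anti closed] by blast
  \<comment> \<open>The function \<open>h\<close> uses the chart picked at \<open>F q\<close>, which
    changes with \<open>q\<close>. By the chain rule the coordinate field of the fixed chart
    \<open>C\<close> reproduces the vectors \<open>T q w\<close>, so the scalar can be computed in
    \<open>C\<close> on all of \<open>U\<close>.\<close>
  have "B (G y) (frechet_derivative G (at y) u) (frechet_derivative G (at y) v) = h u v (chart_inv P y)"
    if "y \<in> U" for u v y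
  proof -
    let ?q = "chart_inv P y"
    have q: "?q \<in> points N" using inU(1)[OF that] charted_chart(3)[OF N P] by blast
    note Fq = mdiff_points(2)[OF mF[OF q]]
    have T: "coord_field M C (frechet_derivative G (at y) w) (F ?q) = T ?q w" for w
      using chart_deriv_compose(2)[OF N M' mF[OF q] mdiff_id[OF M Fq] P inU(1)[OF that] C(1) inU(2)[OF that] chart_at[OF M' Fq]]
      by (simp add: coord_field_def T_def chart_deriv_def[of P C] G_def inU(3)[OF that])
    have "chart_inv C (G y) = F ?q" by (simp add: G_def chart_inv_left[OF M' C(1) inU(2)[OF that]])
    then show ?thesis unfolding B_def kaehler_form_in_chart_def Let_def h_def by (simp add: T)
  qed
  from has_derivative_transform_within_open[OF H(1) U xU this]
  show ?thesis using H(2) by blast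
qed


section \<open>Slices of biwarped products\<close>

text \<open>Finite-dimensional Riesz representation: sending \<open>u\<close> to the coefficients of
  the functional \<open>b u\<close> is injective by definiteness, hence surjective by
  dimension.\<close>

lemma pos_def_representer:
  fixes b :: "'a::euclidean_space \<Rightarrow> 'a \<Rightarrow> real"
  assumes b: "bilinear b" and pos: "\<And>v. v \<noteq> 0 \<Longrightarrow> b v v > 0" and l: "linear l"
  obtains a where "\<And>v. b a v = l v"
proof -
  define L where "L u = (\<Sum>i\<in>Basis. b u i *\<^sub>R i)" for u
  have expand: "m v = (\<Sum>i\<in>Basis. (v \<bullet> i) * m i)" if "linear m" for m :: "'a \<Rightarrow> real" and v
  proof -
    have "m v = m (\<Sum>i\<in>Basis. (v \<bullet> i) *\<^sub>R i)" by (simp add: euclidean_representation)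
    then show ?thesis by (simp add: linear_sum[OF that] linear_cmul[OF that])
  qed
  have bl: "linear (b u)" for u using b by (simp add: bilinear_def)
  have "linear L"
    unfolding L_def
    by (rule linearI) (simp_all add: bilinear_ladd[OF b] bilinear_lmul[OF b] scaleR_add_left sum.distrib
        scaleR_sum_right)
  moreover have "inj L"
  proof (rule linear_injective_0[OF \<open>linear L\<close>, THEN iffD2], intro allI impI)
    fix u assume "L u = 0"
    then have "b u i = 0" if "i \<in> Basis" for i
      using that inner_sum_left_Basis[of i "b u"] by (simp add: L_def)
    then have "b u u = 0" by (subst expand[OF bl]) simp
    then show "u = 0" using pos[of u] by fastforce
  qed
  ultimately obtain a where a: "L a = (\<Sum>i\<in>Basis. l i *\<^sub>R i)"
    using linear_injective_imp_surjective by (metis surjD)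
  have "b a i = l i" if "i \<in> Basis" for i
    using that arg_cong[OF a, of "\<lambda>x. x \<bullet> i"] by (simp add: L_def)
  then have "b a v = l v" for v
    by (subst expand[OF bl], subst expand[OF l]) simp
  then show thesis by (rule that)
qed

text \<open>Resolves the definite description: two candidates differ by a vector of \<open>T\<close>
  that is orthogonal to itself.\<close>

lemma orth_projection_eqI:
  assumes b: "bilinear b" and pos: "\<And>v. v \<noteq> 0 \<Longrightarrow> b v v > 0" and T: "subspace T"
    and t: "t \<in> T" "\<And>s. s \<in> T \<Longrightarrow> b (w - t) s = 0"
  shows "orth_projection b T w = t"
  unfolding orth_projection_def
proof (rule the_equality)
  fix t' assume t': "t' \<in> T \<and> (\<forall>s\<in>T. b (w - t') s = 0)"
  have d: "t' - t \<in> T" using t t' T by (simp add: subspace_diff)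
  have "b (t' - t) (t' - t) = b (w - t) (t' - t) - b (w - t') (t' - t)"
    by (simp add: bilinear_lsub[OF b])
  also have "\<dots> = 0" using t(2)[OF d] t' d by simp
  finally have "\<not> b (t' - t) (t' - t) > 0" by simp
  then show "t' = t" using pos[of "t' - t"] by auto
qed (use t in auto)

text \<open>By Pythagoras the ratio of the lengths lies between 0 and 1, so \<open>cos\<close>
  undoes \<open>arccos\<close>.\<close>

lemma cos_angle_to_subspace:
  assumes b: "bilinear b" and sym: "\<And>u v. b u v = b v u" and pos: "\<And>v. v \<noteq> 0 \<Longrightarrow> b v v > 0"
    and T: "subspace T" and t: "t \<in> T" "\<And>s. s \<in> T \<Longrightarrow> b (w - t) s = 0" and w: "w \<noteq> 0"
  shows "b t t = (cos (angle_to_subspace b w T))\<^sup>2 * b w w"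
proof -
  have nn: "b v v \<ge> 0" for v
    by (cases "v = 0") (auto simp: bilinear_lzero[OF b] intro: less_imp_le[OF pos])
  have "b t (w - t) = 0" using t(2)[OF t(1)] sym by simp
  moreover have "b w w = b (w - t) (w - t) + b (w - t) t + b t (w - t) + b t t"
    by (simp add: bilinear_lsub[OF b] bilinear_rsub[OF b])
  ultimately have le: "b t t \<le> b w w" using t(2)[OF t(1)] nn[of "w - t"] by simp
  have ww: "b w w > 0" by (rule pos[OF w])
  let ?x = "sqrt (b t t) / sqrt (b w w)"
  have "0 \<le> ?x" "?x \<le> 1" using le ww nn[of t] by auto
  then have "cos (angle_to_subspace b w T) = ?x"
    by (simp add: angle_to_subspace_def Let_def orth_projection_eqI[OF b pos T t] cos_arccos)
  then show ?thesis using ww nn[of t] by (simp add: power_divide)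
qed

lemma atlas_prodI:
  "a \<in> atlas M \<Longrightarrow> b \<in> atlas N \<Longrightarrow> (fst a \<times> fst b, map_prod (snd a) (snd b)) \<in> atlas (prod_manifold M N)"
  unfolding atlas_prod by blast

lemma riemannian_metricD:
  assumes "riemannian_metric M g" "p \<in> points M"
  shows "bilinear (g p)" "g p u v = g p v u" "v \<noteq> 0 \<Longrightarrow> g p v v > 0"
  using assms(1)[unfolded riemannian_metric_def, THEN conjunct1, rule_format, OF assms(2)] by auto

section \<open>Slices of the immersion, their differentials and the induced metric\<close>

locale kaehler_biwarped =
  fixes Mbar :: "('m, 'k::euclidean_space) manifold" and J g
    and M_T :: "('a, 'e::euclidean_space) manifold" and g_T
    and M_slant :: "('b, 'f::euclidean_space) manifold" and g_slant
    and M_perp :: "('c, 'h::euclidean_space) manifold" and g_perp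
    and F :: "'a \<times> 'b \<times> 'c \<Rightarrow> 'm"
    and f \<sigma> :: "'a \<Rightarrow> real"
  assumes kaehler: "kaehler_manifold Mbar J g"
    and biwarped: "biwarped_product_submanifold M_T g_T M_slant g_slant M_perp g_perp f \<sigma> Mbar g F"
begin

abbreviation "N \<equiv> prod3_manifold M_T M_slant M_perp"
abbreviation "D_T p q r \<equiv> differential M_T Mbar (\<lambda>p. F (p, q, r)) p"
abbreviation "D_S p q r \<equiv> differential M_slant Mbar (\<lambda>q. F (p, q, r)) q"

lemma factors:
  shows smooth_T: "smooth_manifold M_T" and smooth_S: "smooth_manifold M_slant" and smooth_P: "smooth_manifold M_perp"
    and metric_T: "riemannian_metric M_T g_T" and metric_S: "riemannian_metric M_slant g_slant"
    and metric_P: "riemannian_metric M_perp g_perp"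
    and f_pos: "p \<in> points M_T \<Longrightarrow> f p > 0"
    and smooth_F: "smooth_map N Mbar F"
    and isometric: "x \<in> points N \<Longrightarrow> g (F x) (differential N Mbar F x u) (differential N Mbar F x v) =
          biwarped_metric M_T g_T M_slant g_slant M_perp g_perp f \<sigma> x u v"
  using biwarped
  unfolding biwarped_product_submanifold_def riemannian_manifold_def isometric_immersion_def warping_function_def
  by blast+

lemmas smooth_Mbar = kaehlerD(1)[OF kaehler]
lemmas charted_Mbar = smooth_manifold_charted[OF smooth_Mbar]
lemmas charted_T = smooth_manifold_charted[OF smooth_T]
lemmas charted_S = smooth_manifold_charted[OF smooth_S]
lemmas charted_P = smooth_manifold_charted[OF smooth_P]
lemmas charted_SP = charted_prod[OF charted_S charted_P]
lemmas charted_N = charted_prod[OF charted_T charted_SP]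

lemma mdiff_F: "x \<in> points N \<Longrightarrow> mdiff N Mbar F x"
  by (rule smooth_map_mdiff[OF charted_N smooth_F])

text \<open>The identity of a product is the pairing of its two projections.\<close>

lemma mdiff_id_SP: "x \<in> points (prod_manifold M_slant M_perp) \<Longrightarrow>
    mdiff (prod_manifold M_slant M_perp) (prod_manifold M_slant M_perp) (\<lambda>x. x) x"
  using mdiff_Pair[OF mdiff_fst[OF smooth_S charted_P] mdiff_snd[OF charted_S mdiff_id[OF smooth_P] charted_P]]
  by simp

context
  fixes p q r
  assumes p: "p \<in> points M_T" and q: "q \<in> points M_slant" and r: "r \<in> points M_perp"
begin

lemma pqr: "(p, q, r) \<in> points N" using p q r by simp

lemma Fpqr: "F (p, q, r) \<in> points Mbar" by (rule mdiff_points(2)[OF mdiff_F[OF pqr]])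

lemma mdiff_incl_T: "mdiff M_T N (\<lambda>p. (p, q, r)) p"
  by (intro mdiff_Pair mdiff_id[OF smooth_T p] mdiff_const p q r)

lemma mdiff_incl_S: "mdiff M_slant N (\<lambda>q. (p, q, r)) q"
  by (intro mdiff_Pair mdiff_id[OF smooth_S q] mdiff_const p q r)

lemma mdiff_slice_T: "mdiff M_T Mbar (\<lambda>p. F (p, q, r)) p"
  by (rule mdiff_compose[OF charted_T charted_N mdiff_incl_T mdiff_F[OF pqr]])

lemma mdiff_slice_S: "mdiff M_slant Mbar (\<lambda>q. F (p, q, r)) q"
  by (rule mdiff_compose[OF charted_S charted_N mdiff_incl_S mdiff_F[OF pqr]])

lemma mdiff_pr0: "mdiff N M_T fst (p, q, r)"
  by (rule mdiff_fst[OF smooth_T charted_SP pqr])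

lemma mdiff_pr12: "mdiff N (prod_manifold M_slant M_perp) snd (p, q, r)"
  by (rule mdiff_snd[OF charted_T mdiff_id_SP charted_SP pqr])

lemma mdiff_pr1: "mdiff N M_slant (\<lambda>x. fst (snd x)) (p, q, r)"
  by (rule mdiff_compose[OF charted_N charted_SP mdiff_pr12])
     (use mdiff_fst[OF smooth_S charted_P] q r in simp)

lemma mdiff_pr2: "mdiff N M_perp (\<lambda>x. snd (snd x)) (p, q, r)"
  by (rule mdiff_compose[OF charted_N charted_SP mdiff_pr12])
     (use mdiff_snd[OF charted_S mdiff_id[OF smooth_P] charted_P] q r in simp)

abbreviation "I_T \<equiv> differential M_T N (\<lambda>p. (p, q, r)) p"
abbreviation "I_S \<equiv> differential M_slant N (\<lambda>q. (p, q, r)) q"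

text \<open>The chart picked at \<open>(p, q, r)\<close> need not be the product of the charts
  picked at \<open>p\<close>, \<open>q\<close> and \<open>r\<close>, so \<open>I_T u\<close> need
  not be \<open>(u, 0, 0)\<close>. The chain rule avoids this: every projection composed with an
  inclusion is the identity or a constant.\<close>

lemma proj_incl:
  "differential N M_T fst (p, q, r) (I_T u) = u"
  "differential N M_T fst (p, q, r) (I_S v) = 0"
  "differential N M_slant (\<lambda>x. fst (snd x)) (p, q, r) (I_T u) = 0"
  "differential N M_slant (\<lambda>x. fst (snd x)) (p, q, r) (I_S v) = v"
  "differential N M_perp (\<lambda>x. snd (snd x)) (p, q, r) (I_T u) = 0"
  "differential N M_perp (\<lambda>x. snd (snd x)) (p, q, r) (I_S v) = 0"
  using differential_compose[OF charted_T charted_N charted_T mdiff_incl_T mdiff_pr0, of u]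
    differential_compose[OF charted_S charted_N charted_T mdiff_incl_S mdiff_pr0, of v]
    differential_compose[OF charted_T charted_N charted_S mdiff_incl_T mdiff_pr1, of u]
    differential_compose[OF charted_S charted_N charted_S mdiff_incl_S mdiff_pr1, of v]
    differential_compose[OF charted_T charted_N charted_P mdiff_incl_T mdiff_pr2, of u]
    differential_compose[OF charted_S charted_N charted_P mdiff_incl_S mdiff_pr2, of v]
  by (simp_all add: differential_ident[OF charted_T p] differential_ident[OF charted_S q] differential_const)

lemma D_T_eq: "D_T p q r u = differential N Mbar F (p, q, r) (I_T u)"
  by (rule differential_compose[OF charted_T charted_N charted_Mbar mdiff_incl_T mdiff_F[OF pqr]])

lemma D_S_eq: "D_S p q r u = differential N Mbar F (p, q, r) (I_S u)"
  by (rule differential_compose[OF charted_S charted_N charted_Mbar mdiff_incl_S mdiff_F[OF pqr]])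

lemma bilinear_factors: "bilinear (g_T p)" "bilinear (g_slant q)" "bilinear (g_perp r)"
  by (rule riemannian_metricD, rule metric_T metric_S metric_P, rule p q r)+

lemma metric_D_T_D_S: "g (F (p, q, r)) (D_T p q r u) (D_S p q r v) = 0"
  unfolding D_T_eq D_S_eq isometric[OF pqr] biwarped_metric_def Let_def pullback_form_def comp_def proj_incl
  by (simp add: bilinear_factors[THEN bilinear_rzero] bilinear_factors[THEN bilinear_lzero])

lemma metric_D_S_D_S: "g (F (p, q, r)) (D_S p q r u) (D_S p q r v) = (f p)\<^sup>2 * g_slant q u v"
  unfolding D_T_eq D_S_eq isometric[OF pqr] biwarped_metric_def Let_def pullback_form_def comp_def proj_incl
  by (simp add: bilinear_factors[THEN bilinear_rzero] bilinear_factors[THEN bilinear_lzero])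

text \<open>Links two descriptions of the same vectors: partial derivatives of \<open>F\<close> in a
  product chart, to which closedness applies, and differentials of the slices, of which the
  geometric hypotheses speak.\<close>

lemma slice_derivs:
  assumes a: "a \<in> atlas M_T" "p \<in> fst a" and b: "b \<in> atlas M_slant" "q \<in> fst b" and e: "e \<in> atlas M_perp" "r \<in> fst e"
  defines "P \<equiv> (fst a \<times> fst b \<times> fst e, map_prod (snd a) (map_prod (snd b) (snd e)))"
  shows "chart_deriv P (chart_at Mbar (F (p, q, r))) F (p, q, r) (u, 0, 0) =
      D_T p q r (chart_deriv a (chart_at M_T p) (\<lambda>x. x) p u)"
    and "chart_deriv P (chart_at Mbar (F (p, q, r))) F (p, q, r) (0, v, 0) =
      D_S p q r (chart_deriv b (chart_at M_slant q) (\<lambda>x. x) q v)"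
proof -
  let ?be = "(fst b \<times> fst e, map_prod (snd b) (snd e))"
  have be: "?be \<in> atlas (prod_manifold M_slant M_perp)" "(q, r) \<in> fst ?be"
    using atlas_prodI[OF b(1) e(1)] b(2) e(2) by auto
  have Pe: "P = (fst a \<times> fst ?be, map_prod (snd a) (snd ?be))" by (simp add: P_def)
  have P: "P \<in> atlas N" "(p, q, r) \<in> fst P"
    unfolding Pe using atlas_prodI[OF a(1) be(1)] a(2) be(2) by auto
  let ?C = "chart_at Mbar (F (p, q, r))"
  have C: "?C \<in> atlas Mbar" "F (p, q, r) \<in> fst ?C" by (rule chart_at[OF charted_Mbar Fpqr])+
  have "chart_deriv a P (\<lambda>p. (p, q, r)) p u = (u, 0, 0)"
    unfolding Pe
    by (subst chart_deriv_Pair(2)[OF mdiff_id[OF smooth_T p] mdiff_const[OF p] a a be])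
       (use q r in \<open>simp_all add: chart_deriv_id[OF charted_T a] chart_deriv_const zero_prod_def\<close>)
  then show "chart_deriv P ?C F (p, q, r) (u, 0, 0) = D_T p q r (chart_deriv a (chart_at M_T p) (\<lambda>x. x) p u)"
    unfolding differential_eq_chart_deriv
    using chart_deriv_compose(2)[OF charted_T charted_N mdiff_incl_T mdiff_F[OF pqr] a P C, of u]
      chart_deriv_compose(2)[OF charted_T charted_T mdiff_id[OF smooth_T p] mdiff_slice_T a chart_at[OF charted_T p] C, of u]
    by simp
  have be_S: "chart_deriv b ?be (\<lambda>q. (q, r)) q v = (v, 0)"
    by (subst chart_deriv_Pair(2)[OF mdiff_id[OF smooth_S q] mdiff_const[OF q r] b b e])
       (simp_all add: chart_deriv_id[OF charted_S b] chart_deriv_const)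
  have "chart_deriv b P (\<lambda>q. (p, q, r)) q v = (0, v, 0)"
    unfolding Pe
    by (subst chart_deriv_Pair(2)[OF mdiff_const[OF q p] mdiff_Pair[OF mdiff_id[OF smooth_S q] mdiff_const[OF q r]] b a be])
       (simp only: be_S chart_deriv_const)
  then show "chart_deriv P ?C F (p, q, r) (0, v, 0) = D_S p q r (chart_deriv b (chart_at M_slant q) (\<lambda>x. x) q v)"
    unfolding differential_eq_chart_deriv
    using chart_deriv_compose(2)[OF charted_S charted_N mdiff_incl_S mdiff_F[OF pqr] b P C, of v]
      chart_deriv_compose(2)[OF charted_S charted_S mdiff_id[OF smooth_S q] mdiff_slice_S b chart_at[OF charted_S q] C, of v]
    by simp
qed

end

end


section \<open>Constancy of the warping function of the slant factor\<close>

text \<open>The function is constant on the preimage of a ball in a chart, hence locally constant;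
  connectedness does the rest.\<close>

lemma zero_derivative_imp_constant:
  fixes \<Phi> :: "'a \<Rightarrow> real"
  assumes M: "charted M" and conn: "connected_space (mtop M)"
    and D: "\<And>p a. a \<in> atlas M \<Longrightarrow> p \<in> fst a \<Longrightarrow>
      ((\<lambda>y. \<Phi> (chart_inv a y)) has_derivative (\<lambda>h. 0)) (at (snd a p))"
    and pp': "p \<in> points M" "p' \<in> points M"
  shows "\<Phi> p = \<Phi> p'"
proof -
  have loc: "\<exists>V. openin (mtop M) V \<and> x \<in> V \<and> (\<forall>y\<in>V. \<Phi> y = \<Phi> x)" if x: "x \<in> points M" for x
  proof -
    define a where "a = chart_at M x"
    have a: "a \<in> atlas M" "x \<in> fst a" unfolding a_def by (rule chart_at[OF M x])+
    obtain \<epsilon> where \<epsilon>: "\<epsilon> > 0" "ball (snd a x) \<epsilon> \<subseteq> snd a ` fst a"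
      using openE[OF charted_chart(2)[OF M a(1)] imageI[OF a(2)]] by metis
    have "((\<lambda>y. \<Phi> (chart_inv a y)) has_derivative (\<lambda>h. 0)) (at y within ball (snd a x) \<epsilon>)"
      if "y \<in> ball (snd a x) \<epsilon>" for y
    proof -
      have y: "y \<in> snd a ` fst a" using that \<epsilon>(2) by blast
      show ?thesis
        using D[OF a(1) chart_inv_in[OF y]] unfolding chart_inv_right[OF y] by (rule has_derivative_at_withinI)
    qed
    then obtain c where c: "\<And>y. y \<in> ball (snd a x) \<epsilon> \<Longrightarrow> \<Phi> (chart_inv a y) = c"
      using has_derivative_zero_constant[OF convex_ball] by metis
    have x': "chart_inv a (snd a x) = x" by (rule chart_inv_left[OF M a])
    show ?thesis
    proof (intro exI conjI ballI)
      show "openin (mtop M) (chart_inv a ` ball (snd a x) \<epsilon>)"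
        by (rule openin_chart_inv_image[OF M a(1) open_ball \<epsilon>(2)])
      have b: "snd a x \<in> ball (snd a x) \<epsilon>" using \<epsilon>(1) by simp
      show "x \<in> chart_inv a ` ball (snd a x) \<epsilon>" using imageI[OF b, of "chart_inv a"] x' by simp
      show "\<Phi> y = \<Phi> x" if "y \<in> chart_inv a ` ball (snd a x) \<epsilon>" for y
        using that c c[OF b] x' by auto
    qed
  qed
  \<comment> \<open>An arbitrary predicate \<open>Q\<close> covers the level set through
    \<open>p\<close> and its complement at once.\<close>
  have op: "openin (mtop M) {x \<in> points M. Q (\<Phi> x)}" for Q
  proof (subst openin_subopen, intro ballI)
    fix x assume "x \<in> {x \<in> points M. Q (\<Phi> x)}"
    then have x: "x \<in> points M" "Q (\<Phi> x)" by auto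
    obtain V where V: "openin (mtop M) V" "x \<in> V" "\<forall>y\<in>V. \<Phi> y = \<Phi> x" using loc[OF x(1)] by blast
    have "V \<subseteq> {x \<in> points M. Q (\<Phi> x)}" using V(3) x(2) openin_subset[OF V(1)] by auto
    then show "\<exists>T. openin (mtop M) T \<and> x \<in> T \<and> T \<subseteq> {x \<in> points M. Q (\<Phi> x)}" using V by blast
  qed
  show ?thesis
  proof (rule ccontr)
    assume "\<Phi> p \<noteq> \<Phi> p'"
    then show False
      using conn op[of "\<lambda>t. t = \<Phi> p"] op[of "\<lambda>t. t \<noteq> \<Phi> p"] pp'
      unfolding connected_space_def
      by (elim notE, intro exI[of _ "{x \<in> points M. \<Phi> x = \<Phi> p}"] exI[of _ "{x \<in> points M. \<Phi> x \<noteq> \<Phi> p}"]) auto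
  qed
qed

context kaehler_biwarped
begin

context
  assumes holomorphic: "\<And>q r. q \<in> points M_slant \<Longrightarrow> r \<in> points M_perp \<Longrightarrow>
    holomorphic_submanifold M_T Mbar J (\<lambda>p. F (p, q, r))"
begin

text \<open>Both orders of the arguments are recorded because the cyclic sum contains one mixed
  component of each kind.\<close>

lemma kaehler_form_D_T_D_S:
  assumes "p \<in> points M_T" "q \<in> points M_slant" "r \<in> points M_perp"
  shows "g (F (p, q, r)) (J (F (p, q, r)) (D_T p q r u)) (D_S p q r v) = 0"
    and "g (F (p, q, r)) (J (F (p, q, r)) (D_S p q r v)) (D_T p q r u) = 0"
proof -
  obtain u' where "J (F (p, q, r)) (D_T p q r u) = D_T p q r u'"
    using holomorphic[OF assms(2,3), unfolded holomorphic_submanifold_def tangent_image_def,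
        rule_format, OF assms(1), THEN subsetD, OF imageI, OF rangeI, of u] by (elim rangeE)
  then show "g (F (p, q, r)) (J (F (p, q, r)) (D_T p q r u)) (D_S p q r v) = 0"
    using metric_D_T_D_S[OF assms] by simp
  then show "g (F (p, q, r)) (J (F (p, q, r)) (D_S p q r v)) (D_T p q r u) = 0"
    by (subst kaehler_form_antisym[OF kaehler Fpqr[OF assms]]) simp
qed

text \<open>Closedness of the pulled-back Kaehler form, evaluated on one coordinate direction of
  \<open>M_T\<close> and two of \<open>M_slant\<close>; the mixed components vanish identically.\<close>

lemma kaehler_form_D_S_derivative:
  assumes a: "a \<in> atlas M_T" "p \<in> fst a" and q: "q \<in> points M_slant" and r: "r \<in> points M_perp"
  shows "((\<lambda>y. g (F (chart_inv a y, q, r)) (J (F (chart_inv a y, q, r)) (D_S (chart_inv a y) q r v))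
      (D_S (chart_inv a y) q r w)) has_derivative (\<lambda>h. 0)) (at (snd a p))"
proof -
  \<comment> \<open>The chart \<open>a\<close> is arbitrary, as
    \<open>zero_derivative_imp_constant\<close> requires, but at \<open>q\<close> the chart fixed
    there is taken, so that \<open>v\<close> and \<open>w\<close> need no conversion.\<close>
  define b where "b = chart_at M_slant q"
  define e where "e = chart_at M_perp r"
  define P where "P = (fst a \<times> fst b \<times> fst e, map_prod (snd a) (map_prod (snd b) (snd e)))"
  have b: "b \<in> atlas M_slant" "q \<in> fst b" unfolding b_def by (rule chart_at[OF charted_S q])+
  have e: "e \<in> atlas M_perp" "r \<in> fst e" unfolding e_def by (rule chart_at[OF charted_P r])+
  have P: "P \<in> atlas N" "(p, q, r) \<in> fst P"
    using atlas_prodI[OF a(1) atlas_prodI[OF b(1) e(1)]] a(2) b(2) e(2) unfolding P_def by auto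
  define T where "T x = chart_deriv P (chart_at Mbar (F x)) F x" for x
  define h where "h u v x = g (F x) (J (F x) (T x u)) (T x v)" for u v x
  obtain H where H: "((\<lambda>y. h u v (chart_inv P y)) has_derivative H u v) (at (snd P (p, q, r)))"
    "H u v w + H v w u + H w u v = 0" for u v w
    using pullback_closed[OF kaehler charted_N smooth_F P] unfolding h_def T_def by blast
  have T: "T (p', q', r') (u, 0, 0) = D_T p' q' r' (chart_deriv a (chart_at M_T p') (\<lambda>x. x) p' u)"
      "T (p', q', r') (0, v, 0) = D_S p' q' r' (chart_deriv b (chart_at M_slant q') (\<lambda>x. x) q' v)"
    if "(p', q', r') \<in> fst P" for p' q' r' u v
  proof -
    have mem: "p' \<in> fst a" "q' \<in> fst b" "r' \<in> fst e" using that unfolding P_def by auto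
    then have "p' \<in> points M_T" "q' \<in> points M_slant" "r' \<in> points M_perp"
      using charted_chart(3)[OF charted_T a(1)] charted_chart(3)[OF charted_S b(1)]
        charted_chart(3)[OF charted_P e(1)] by blast+
    note derivs = slice_derivs[OF this a(1) mem(1) b(1) mem(2) e(1) mem(3), folded P_def T_def]
    show "T (p', q', r') (u, 0, 0) = D_T p' q' r' (chart_deriv a (chart_at M_T p') (\<lambda>x. x) p' u)"
      "T (p', q', r') (0, v, 0) = D_S p' q' r' (chart_deriv b (chart_at M_slant q') (\<lambda>x. x) q' v)"
      by (rule derivs)+
  qed
  have h0: "h (u, 0, 0) (0, v, 0) x = 0" "h (0, v, 0) (u, 0, 0) x = 0" if x: "x \<in> fst P" for u v x
  proof -
    obtain p' q' r' where pqr': "x = (p', q', r')" by (cases x) auto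
    have "p' \<in> points M_T" "q' \<in> points M_slant" "r' \<in> points M_perp"
      using charted_chart(3)[OF charted_N P(1)] x unfolding pqr' points_prod by auto
    then show "h (u, 0, 0) (0, v, 0) x = 0" "h (0, v, 0) (u, 0, 0) x = 0"
      using kaehler_form_D_T_D_S T x unfolding h_def pqr' by simp_all
  qed
  \<comment> \<open>Vanishing on the whole chart domain, not just at one point, is what kills the
    derivatives of the mixed components, also those along \<open>M_slant\<close>.\<close>
  have zero: "H z z' = (\<lambda>_. 0)" if "\<And>x. x \<in> fst P \<Longrightarrow> h z z' x = 0" for z z'
  proof -
    have "((\<lambda>y. h z z' (chart_inv P y)) has_derivative (\<lambda>_. 0)) (at (snd P (p, q, r)))"
    proof (rule has_derivative_transform_within_open[OF has_derivative_const charted_chart(2)[OF charted_N P(1)]])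
      show "snd P (p, q, r) \<in> snd P ` fst P" by (rule imageI[OF P(2)])
      show "0 = h z z' (chart_inv P y)" if "y \<in> snd P ` fst P" for y
        using \<open>\<And>x. x \<in> fst P \<Longrightarrow> h z z' x = 0\<close>[OF chart_inv_in[OF that]] by simp
    qed
    from has_derivative_unique[OF H(1) this] show ?thesis .
  qed
  \<comment> \<open>The two other cyclic terms differentiate mixed components along
    \<open>M_slant\<close>; what remains is the derivative along \<open>M_T\<close> of the component
    on two slant directions.\<close>
  have "H (0, v, 0) (0, w, 0) (u, 0, 0) = 0" for u
    using H(2)[of "(u, 0, 0)" "(0, v, 0)" "(0, w, 0)"] zero[of "(u, 0, 0)" "(0, v, 0)"]
      zero[of "(0, w, 0)" "(u, 0, 0)"] h0 by simp
  then have H0: "(\<lambda>u. H (0, v, 0) (0, w, 0) (u, 0, 0)) = (\<lambda>_. 0)" by blast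
  \<comment> \<open>Restricts the derivative in the product chart to the slice through fixed
    \<open>q\<close> and \<open>r\<close>.\<close>
  have 1: "((\<lambda>y. (y, snd b q, snd e r)) has_derivative (\<lambda>u. (u, 0, 0))) (at (snd a p))"
    by (intro has_derivative_Pair has_derivative_ident has_derivative_const)
  have "((\<lambda>y. h (0, v, 0) (0, w, 0) (chart_inv P y)) has_derivative H (0, v, 0) (0, w, 0))
      (at (snd a p, snd b q, snd e r))"
    using H(1) by (simp add: P_def)
  from has_derivative_compose[OF 1 this]
  have "((\<lambda>y. h (0, v, 0) (0, w, 0) (chart_inv P (y, snd b q, snd e r))) has_derivative (\<lambda>_. 0)) (at (snd a p))"
    unfolding H0 .
  then show ?thesis
  proof (rule has_derivative_transform_within_open[OF _ charted_chart(2)[OF charted_T a(1)] imageI[OF a(2)]])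
    fix y assume y: "y \<in> snd a ` fst a"
    have "chart_inv (fst b \<times> fst e, map_prod (snd b) (snd e)) (snd b q, snd e r) = (q, r)"
      using chart_inv_prod[OF charted_S charted_P b(1) e(1) imageI[OF b(2)] imageI[OF e(2)]]
      by (simp add: chart_inv_left[OF charted_S b] chart_inv_left[OF charted_P e])
    then have "chart_inv P (y, snd b q, snd e r) = (chart_inv a y, q, r)"
      using chart_inv_prod[OF charted_T charted_SP a(1) atlas_prodI[OF b(1) e(1)] y, of "(snd b q, snd e r)"] b(2) e(2)
      unfolding P_def by auto
    moreover have "(chart_inv a y, q, r) \<in> fst P" using chart_inv_in[OF y] b e by (simp add: P_def)
    moreover have "chart_deriv b (chart_at M_slant q) (\<lambda>x. x) q z = z" for z
      unfolding b_def[symmetric] by (rule chart_deriv_id[OF charted_S b])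
    ultimately show "h (0, v, 0) (0, w, 0) (chart_inv P (y, snd b q, snd e r)) =
        g (F (chart_inv a y, q, r)) (J (F (chart_inv a y, q, r)) (D_S (chart_inv a y) q r v)) (D_S (chart_inv a y) q r w)"
      using T(2) unfolding h_def by simp
  qed
qed

lemma kaehler_form_D_S_constant:
  assumes "connected_space (mtop M_T)" "p \<in> points M_T" "p' \<in> points M_T" "q \<in> points M_slant" "r \<in> points M_perp"
  shows "g (F (p, q, r)) (J (F (p, q, r)) (D_S p q r v)) (D_S p q r w) =
    g (F (p', q, r)) (J (F (p', q, r)) (D_S p' q r v)) (D_S p' q r w)"
  by (rule zero_derivative_imp_constant[OF charted_T assms(1) kaehler_form_D_S_derivative[OF _ _ assms(4,5)] assms(2,3)])

end

text \<open>The exponent 4 combines two effects of the metric \<open>(f p)\<^sup>2 * g_slant\<close>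
  on the slice: \<open>J\<close> preserves the squared length
  \<open>(f p)\<^sup>2 * g_slant q z z\<close> of the image of \<open>z\<close>, while the
  tangential part, the image of \<open>A\<close> divided by \<open>(f p)\<^sup>2\<close>, has
  squared length \<open>g_slant q A A / (f p)\<^sup>2\<close>.\<close>

lemma slant_warping:
  assumes p: "p \<in> points M_T" and q: "q \<in> points M_slant" and r: "r \<in> points M_perp"
    and slant: "slant_submanifold M_slant Mbar J g (\<lambda>q. F (p, q, r)) \<phi>"
    and z: "z \<noteq> 0"
    and A: "\<And>s. g_slant q A s = g (F (p, q, r)) (J (F (p, q, r)) (D_S p q r z)) (D_S p q r s)"
  shows "g_slant q A A = (cos \<phi>)\<^sup>2 * (f p) ^ 4 * g_slant q z z"
proof -
  note pqr = p q r
  let ?b = "g (F (p, q, r))" and ?D = "D_S p q r" and ?J = "J (F (p, q, r))"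
  note m = Fpqr[OF pqr]
  have b: "bilinear ?b" by (rule kaehlerD(3)[OF kaehler m])
  have pos: "v \<noteq> 0 \<Longrightarrow> ?b v v > 0" for v by (rule kaehlerD(5)[OF kaehler m])
  have lin: "linear ?D" by (rule linear_differential[OF charted_S charted_Mbar mdiff_slice_S[OF pqr]])
  have f: "f p > 0" by (rule f_pos[OF p])
  have gb: "bilinear (g_slant q)" by (rule riemannian_metricD(1)[OF metric_S q])
  \<comment> \<open>The tangential part of \<open>?J (?D z)\<close>: \<open>A\<close> represents the
    form for \<open>g_slant\<close>, and the scaling converts to the induced metric.\<close>
  define t where "t = ?D ((1 / (f p)\<^sup>2) *\<^sub>R A)"
  have "?b (?D z) (?D z) > 0"
    using f riemannian_metricD(3)[OF metric_S q z] by (simp add: metric_D_S_D_S[OF pqr])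
  \<comment> \<open>The slant condition concerns nonzero tangent vectors, and the angle formula
    divides by the length of \<open>?J (?D z)\<close>.\<close>
  then have Dz: "?D z \<noteq> 0" and Jz: "?J (?D z) \<noteq> 0"
    using kaehlerD(8)[OF kaehler m, of "?D z" "?D z"] by (auto simp: bilinear_lzero[OF b])
  have orth: "?b (?J (?D z) - t) s = 0" if "s \<in> range ?D" for s
  proof -
    from that obtain s' where s: "s = ?D s'" by blast
    show ?thesis
      using f unfolding s t_def bilinear_lsub[OF b] metric_D_S_D_S[OF pqr] bilinear_lmul[OF gb] A[symmetric] by simp
  qed
  have "angle_to_subspace ?b (?J (?D z)) (range ?D) = \<phi>"
    using slant q Dz unfolding slant_submanifold_def tangent_image_def by blast
  moreover have "?b t t = (cos (angle_to_subspace ?b (?J (?D z)) (range ?D)))\<^sup>2 * ?b (?J (?D z)) (?J (?D z))"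
    by (rule cos_angle_to_subspace[OF b kaehlerD(4)[OF kaehler m] pos _ _ orth Jz])
       (auto simp: t_def intro: linear_subspace_image[OF lin] subspace_UNIV)
  ultimately have "?b t t = (cos \<phi>)\<^sup>2 * ((f p)\<^sup>2 * g_slant q z z)"
    by (simp add: kaehlerD(8)[OF kaehler m] metric_D_S_D_S[OF pqr])
  moreover have "?b t t = g_slant q A A / (f p)\<^sup>2"
    unfolding t_def metric_D_S_D_S[OF pqr] bilinear_lmul[OF gb] bilinear_rmul[OF gb]
    using f by (simp add: field_simps power2_eq_square)
  ultimately show ?thesis using f by (simp add: field_simps power4_eq_xxxx power2_eq_square)
qed

end

theorem corollary4p3:
  fixes Mbar :: "('m, 'k::euclidean_space) manifold"
    and M_T :: "('a, 'e::euclidean_space) manifold"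
    and M_slant :: "('b, 'f::euclidean_space) manifold"
    and M_perp :: "('c, 'h::euclidean_space) manifold"
    and F :: "'a \<times> 'b \<times> 'c \<Rightarrow> 'm"
    and f \<sigma> :: "'a \<Rightarrow> real"
    and \<phi> :: real
  assumes "kaehler_manifold Mbar J g"
    and "biwarped_product_submanifold M_T g_T M_slant g_slant M_perp g_perp f \<sigma> Mbar g F"
    and "connected_space (mtop M_T)"
    and "\<And>q r. q \<in> points M_slant \<Longrightarrow> r \<in> points M_perp \<Longrightarrow>
           holomorphic_submanifold M_T Mbar J (\<lambda>p. F (p, q, r))"
    and "\<And>p r. p \<in> points M_T \<Longrightarrow> r \<in> points M_perp \<Longrightarrow>
           proper_slant_submanifold M_slant Mbar J g (\<lambda>q. F (p, q, r)) \<phi>"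
    and "\<And>p q. p \<in> points M_T \<Longrightarrow> q \<in> points M_slant \<Longrightarrow>
           totally_real_submanifold M_perp Mbar J g (\<lambda>r. F (p, q, r))"
  shows "f constant_on points M_T"
proof -
  interpret kaehler_biwarped Mbar J g M_T g_T M_slant g_slant M_perp g_perp F f \<sigma>
    by unfold_locales (fact assms(1,2))+
  obtain q where q: "q \<in> points M_slant" using smooth_S unfolding smooth_manifold_def by blast
  obtain r where r: "r \<in> points M_perp" using smooth_P unfolding smooth_manifold_def by blast
  \<comment> \<open>Model spaces have positive dimension, so a nonzero test vector exists.\<close>
  obtain z :: 'f where z: "z \<noteq> 0" using nonzero_Basis nonempty_Basis by blast
  have "f p = f p'" if p: "p \<in> points M_T" and p': "p' \<in> points M_T" for p p'
  proof -
    note m = Fpqr[OF p q r]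
    have gq: "bilinear (g_slant q)" "\<And>v. v \<noteq> 0 \<Longrightarrow> g_slant q v v > 0"
      by (rule riemannian_metricD[OF metric_S q])+
    have "linear (\<lambda>s. g (F (p, q, r)) (J (F (p, q, r)) (D_S p q r z)) (D_S p q r s))"
      using linear_compose[OF linear_differential[OF charted_S charted_Mbar mdiff_slice_S[OF p q r]],
          of "g (F (p, q, r)) (J (F (p, q, r)) (D_S p q r z))"] kaehlerD(3)[OF kaehler m]
      by (simp add: bilinear_def comp_def)
    from pos_def_representer[OF gq this]
    obtain A where A: "\<And>s. g_slant q A s = g (F (p, q, r)) (J (F (p, q, r)) (D_S p q r z)) (D_S p q r s)"
      by blast
    have slant: "slant_submanifold M_slant Mbar J g (\<lambda>q. F (x, q, r)) \<phi>" and cos: "cos \<phi> \<noteq> 0"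
      if "x \<in> points M_T" for x
      using assms(5)[OF that r] unfolding proper_slant_submanifold_def by auto
    have "g_slant q A A = (cos \<phi>)\<^sup>2 * (f p) ^ 4 * g_slant q z z"
      by (rule slant_warping[OF p q r slant[OF p] z A])
    \<comment> \<open>The vector \<open>A\<close> built at \<open>p\<close> also represents the form
      at \<open>p'\<close>, because the form on the slant slice is the same at both points.\<close>
    moreover have "g_slant q A A = (cos \<phi>)\<^sup>2 * (f p') ^ 4 * g_slant q z z"
      by (rule slant_warping[OF p' q r slant[OF p'] z])
         (simp add: A kaehler_form_D_S_constant[OF assms(4) assms(3) p p' q r])
    ultimately have "(f p) ^ 4 = (f p') ^ 4" using cos[OF p] gq(2)[OF z] by simp
    then show ?thesis
      using power_eq_imp_eq_base[of "f p" 4 "f p'"] f_pos[OF p] f_pos[OF p'] by simp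
  qed
  then show ?thesis unfolding constant_on_def by blast
qed

end
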